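(* Let $\Omega\subset\mathbb{R}^2$ be a smoothly $1$-cracked set of class $C^2$, i.e. $\Omega=\tilde\Omega\setminus\Sigma$ where $\tilde\Omega\subset\mathbb{R}^2$ is an open and bounded set with $C^2$-boundary and $\Sigma\subset\tilde\Omega$ is a closed, bounded and simply connected $1$-dimensional $C^2$-submanifold of $\mathbb{R}^2$ (with boundary). Set $M:=\Sigma$ and write $\partial M=\{A,B\}$. Let $J$ be a real-valued shape function and suppose that the Eulerian semi-derivative $dJ(\Omega)(X)$ exists for all $X\in C^1_c(\tilde\Omega,\mathbb{R}^2)$ and that $dJ(\Omega):C^1_c(\tilde\Omega,\mathbb{R}^2)\to\mathbb{R}$ is linear and continuous. Then there are real numbers $\alpha_1,\alpha_2$ and a linear and continuous functional $\bar h:C^1(M)\to\mathbb{R}$ such that $$dJ(\Omega)(X)=\alpha_1(X\cdot\nu)(A)+\alpha_2(X\cdot\nu)(B)+\bar h(X|_M\cdot\mathfrak{n})\qquad\text{for all }X\in C^1_c(\tilde\Omega,\mathbb{R}^2),$$ where $\mathfrak{n}$ is a (continuous) unit normal field along $M$ and $\nu$ is the outward-pointing unit vector field on $\partial M$.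
   Context: A closed, bounded, simply connected (in particular connected) $1$-dimensional submanifold with boundary $\{A,B\}$ is an embedded compact arc with end points $A,B$. For $p\in\partial M$, $\nu(p)$ is the unit vector in the tangent line $T_pM$ pointing out of $M$ (so $\nu$ is tangent to the crack at its tips). Eulerian semi-derivative: for $X\in C^1_c(\tilde\Omega,\mathbb{R}^2)$ ($C^1$ vector fields with compact support in $\tilde\Omega$), $\Phi_t$ denotes the flow of $X$, $\frac{d}{dt}\Phi_t(x)=X(\Phi_t(x))$, $\Phi_0(x)=x$. For a function $J:\Xi\to\mathbb{R}$ on a set $\Xi$ of subsets of $\mathbb{R}^2$ and $\Omega\in\Xi$ such that $\Phi_t(\Omega)\in\Xi$ for all small $t>0$, $$dJ(\Omega)(X):=\lim_{t\searrow0}\frac{J(\Phi_t(\Omega))-J(\Omega)}{t}.$$ Continuity on $C^1_c(\tilde\Omega,\mathbb{R}^2)$ is with respect to the seminorms $\|f\|_{K,\alpha}=\sup_{x\in K}|\partial^\alpha f(x)|$, $K\subset\tilde\Omega$ compact, $|\alpha|\le1$. $C^1(M)$ carries its usual $C^1$-norm. *)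

theory Defs
  imports "HOL-Analysis.Analysis"
begin

section \<open>Maps and diffeomorphisms of class C1 and C2\<close>

definition C1_on :: "'a::real_normed_vector set \<Rightarrow> ('a \<Rightarrow> 'b::real_normed_vector) \<Rightarrow> bool" where
  "C1_on U f \<longleftrightarrow> (\<exists>f' :: 'a \<Rightarrow> 'a \<Rightarrow>\<^sub>L 'b.
     (\<forall>x\<in>U. (f has_derivative blinfun_apply (f' x)) (at x)) \<and> continuous_on U f')"

definition C2_on :: "'a::real_normed_vector set \<Rightarrow> ('a \<Rightarrow> 'b::real_normed_vector) \<Rightarrow> bool" where
  "C2_on U f \<longleftrightarrow> (\<exists>f' :: 'a \<Rightarrow> 'a \<Rightarrow>\<^sub>L 'b.
     (\<forall>x\<in>U. (f has_derivative blinfun_apply (f' x)) (at x)) \<and> C1_on U f')"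

definition C2_diffeo :: "(real^2) set \<Rightarrow> (real^2) set \<Rightarrow> (real^2 \<Rightarrow> real^2) \<Rightarrow> bool" where
  "C2_diffeo U V \<phi> \<longleftrightarrow>
     open U \<and> open V \<and> bij_betw \<phi> U V \<and> C2_on U \<phi> \<and> C2_on V (inv_into U \<phi>)"

text \<open>A set with C2-boundary lies locally on one side of its boundary.\<close>

definition C2_boundary :: "(real^2) set \<Rightarrow> bool" where
  "C2_boundary D \<longleftrightarrow> (\<forall>p\<in>frontier D. \<exists>U V \<phi>. p \<in> U \<and> C2_diffeo U V \<phi> \<and>
     \<phi> ` (U \<inter> D) = V \<inter> {y. y $ 2 > 0} \<and>
     \<phi> ` (U \<inter> frontier D) = V \<inter> {y. y $ 2 = 0})"

section \<open>One-dimensional submanifolds with boundary\<close>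

text \<open>
  A chart straightens the submanifold to a relatively open part of the half-line
  $[0,\infty) \times \{0\}$. It need not send a given point to the origin: interior points are
  those sent to the open half-line, boundary points those sent to the origin.
\<close>

definition submanifold_chart ::
  "(real^2) set \<Rightarrow> (real^2) set \<Rightarrow> (real^2) set \<Rightarrow> (real^2 \<Rightarrow> real^2) \<Rightarrow> bool" where
  "submanifold_chart M U V \<phi> \<longleftrightarrow> C2_diffeo U V \<phi> \<and>
     \<phi> ` (U \<inter> M) = V \<inter> {y. y $ 1 \<ge> 0 \<and> y $ 2 = 0}"

definition C2_submanifold :: "(real^2) set \<Rightarrow> bool" where
  "C2_submanifold M \<longleftrightarrow> (\<forall>p\<in>M. \<exists>U V \<phi>. p \<in> U \<and> submanifold_chart M U V \<phi>)"

definition mfd_boundary :: "(real^2) set \<Rightarrow> (real^2) set" where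
  "mfd_boundary M = {p \<in> M. \<exists>U V \<phi>. p \<in> U \<and> submanifold_chart M U V \<phi> \<and> \<phi> p = 0}"

definition tangent_space :: "(real^2) set \<Rightarrow> real^2 \<Rightarrow> (real^2) set" where
  "tangent_space M p = {v. \<exists>U V \<phi>. p \<in> U \<and> submanifold_chart M U V \<phi> \<and>
     frechet_derivative \<phi> (at p) v $ 2 = 0}"

text \<open>In a chart sending the boundary point p to the origin, M is the half-line of
  nonnegative first coordinates, so a negative first component points out of M.\<close>

definition outward_unit :: "(real^2) set \<Rightarrow> real^2 \<Rightarrow> real^2 \<Rightarrow> bool" where
  "outward_unit M p v \<longleftrightarrow> norm v = 1 \<and> v \<in> tangent_space M p \<and>
     (\<exists>U V \<phi>. p \<in> U \<and> submanifold_chart M U V \<phi> \<and> \<phi> p = 0 \<and>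
        frechet_derivative \<phi> (at p) v $ 1 < 0)"

definition unit_normal_field :: "(real^2) set \<Rightarrow> (real^2 \<Rightarrow> real^2) \<Rightarrow> bool" where
  "unit_normal_field M n \<longleftrightarrow> continuous_on M n \<and>
     (\<forall>p\<in>M. norm (n p) = 1 \<and> (\<forall>v\<in>tangent_space M p. n p \<bullet> v = 0))"

definition smoothly_1_cracked :: "(real^2) set \<Rightarrow> (real^2) set \<Rightarrow> (real^2) set \<Rightarrow> bool" where
  "smoothly_1_cracked \<Omega> D M \<longleftrightarrow>
     open D \<and> bounded D \<and> C2_boundary D \<and>
     M \<subseteq> D \<and> closed M \<and> bounded M \<and> simply_connected M \<and> C2_submanifold M \<and>
     \<Omega> = D - M"

section \<open>Function spaces and linear functionals\<close>

text \<open>The topology generated by a set P of seminorms on a space V of functions.\<close>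

definition seminorm_topology ::
  "('a \<Rightarrow> 'b::real_vector) set \<Rightarrow> (('a \<Rightarrow> 'b) \<Rightarrow> real) set \<Rightarrow> ('a \<Rightarrow> 'b) topology" where
  "seminorm_topology V P = topology_generated_by
     {{f \<in> V. p (\<lambda>x. f x - g x) < e} | p g e. p \<in> P \<and> g \<in> V \<and> e > 0}"

definition linear_functional_on ::
  "('a \<Rightarrow> 'b::real_vector) set \<Rightarrow> (('a \<Rightarrow> 'b) \<Rightarrow> real) \<Rightarrow> bool" where
  "linear_functional_on V L \<longleftrightarrow>
     (\<forall>f\<in>V. \<forall>g\<in>V. L (\<lambda>x. f x + g x) = L f + L g) \<and>
     (\<forall>f\<in>V. \<forall>c. L (\<lambda>x. c *\<^sub>R f x) = c * L f)"

text \<open>Compactly supported fields on D are identified with their extensions by zero.\<close>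

definition C1c :: "(real^2) set \<Rightarrow> (real^2 \<Rightarrow> real^2) set" where
  "C1c D = {X. C1_on UNIV X \<and> compact (closure {x. X x \<noteq> 0}) \<and> closure {x. X x \<noteq> 0} \<subseteq> D}"

text \<open>Multi-indices of order at most one: None is the zero multi-index, Some i the
  i-th unit multi-index.\<close>

definition partial_deriv :: "2 option \<Rightarrow> (real^2 \<Rightarrow> real^2) \<Rightarrow> real^2 \<Rightarrow> real^2" where
  "partial_deriv \<alpha> f x =
     (case \<alpha> of None \<Rightarrow> f x | Some i \<Rightarrow> frechet_derivative f (at x) (axis i 1))"

definition C1c_seminorm :: "(real^2) set \<Rightarrow> 2 option \<Rightarrow> (real^2 \<Rightarrow> real^2) \<Rightarrow> real" where
  "C1c_seminorm K \<alpha> f = (SUP x\<in>K. norm (partial_deriv \<alpha> f x))"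

definition C1c_topology :: "(real^2) set \<Rightarrow> (real^2 \<Rightarrow> real^2) topology" where
  "C1c_topology D = seminorm_topology (C1c D)
     {C1c_seminorm K \<alpha> | K \<alpha>. compact K \<and> K \<noteq> {} \<and> K \<subseteq> D}"

text \<open>The tangential gradient is the tangent vector representing the derivative of f along M.\<close>

definition has_tangential_gradient ::
  "(real^2) set \<Rightarrow> (real^2 \<Rightarrow> real) \<Rightarrow> real^2 \<Rightarrow> real^2 \<Rightarrow> bool" where
  "has_tangential_gradient M f p v \<longleftrightarrow>
     v \<in> tangent_space M p \<and> (f has_derivative (\<lambda>h. v \<bullet> h)) (at p within M)"

definition tangential_gradient :: "(real^2) set \<Rightarrow> (real^2 \<Rightarrow> real) \<Rightarrow> real^2 \<Rightarrow> real^2" where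
  "tangential_gradient M f p = (THE v. has_tangential_gradient M f p v)"

text \<open>Functions on M are represented by their extensions by zero, so that linear operations on
  functions on M are pointwise operations.\<close>

definition C1_mfd :: "(real^2) set \<Rightarrow> (real^2 \<Rightarrow> real) set" where
  "C1_mfd M = {f. (\<forall>x. x \<notin> M \<longrightarrow> f x = 0) \<and>
     (\<exists>G. continuous_on M G \<and> (\<forall>p\<in>M. has_tangential_gradient M f p (G p)))}"

definition C1_mfd_norm :: "(real^2) set \<Rightarrow> (real^2 \<Rightarrow> real) \<Rightarrow> real" where
  "C1_mfd_norm M f = (SUP p\<in>M. \<bar>f p\<bar>) + (SUP p\<in>M. norm (tangential_gradient M f p))"

definition C1_mfd_topology :: "(real^2) set \<Rightarrow> (real^2 \<Rightarrow> real) topology" where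
  "C1_mfd_topology M = seminorm_topology (C1_mfd M) {C1_mfd_norm M}"

section \<open>Flows and the Eulerian semi-derivative\<close>

definition is_flow :: "(real^2 \<Rightarrow> real^2) \<Rightarrow> (real \<Rightarrow> real^2 \<Rightarrow> real^2) \<Rightarrow> bool" where
  "is_flow X \<Phi> \<longleftrightarrow> (\<forall>x. \<Phi> 0 x = x) \<and>
     (\<forall>x t. ((\<lambda>s. \<Phi> s x) has_vector_derivative X (\<Phi> t x)) (at t))"

text \<open>A compactly supported C1 field has exactly one flow, defined for all times.\<close>

definition flow :: "(real^2 \<Rightarrow> real^2) \<Rightarrow> real \<Rightarrow> real^2 \<Rightarrow> real^2" where
  "flow X = (THE \<Phi>. is_flow X \<Phi>)"

text \<open>Only the values of J on \<open>\<Xi>\<close> matter.\<close>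

definition has_eulerian_semiderivative ::
  "(real^2) set set \<Rightarrow> ((real^2) set \<Rightarrow> real) \<Rightarrow> (real^2) set \<Rightarrow> (real^2 \<Rightarrow> real^2) \<Rightarrow> real \<Rightarrow> bool"
  where
  "has_eulerian_semiderivative \<Xi> J \<Omega> X l \<longleftrightarrow>
     \<Omega> \<in> \<Xi> \<and> (\<forall>\<^sub>F t in at_right 0. flow X t ` \<Omega> \<in> \<Xi>) \<and>
     ((\<lambda>t. (J (flow X t ` \<Omega>) - J \<Omega>) / t) \<longlongrightarrow> l) (at_right 0)"

definition eulerian_semiderivative ::
  "(real^2) set set \<Rightarrow> ((real^2) set \<Rightarrow> real) \<Rightarrow> (real^2) set \<Rightarrow> (real^2 \<Rightarrow> real^2) \<Rightarrow> real"
  where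
  "eulerian_semiderivative \<Xi> J \<Omega> X = (THE l. has_eulerian_semiderivative \<Xi> J \<Omega> X l)"

end

theory Submission
  imports Defs
begin

text \<open>
  The derivative annihilates every field \<open>X\<close> with \<open>X \<bullet> n = 0\<close> on \<open>M\<close> that vanishes at \<open>A\<close> and
  \<open>B\<close>: its flow maps \<open>M\<close>, hence \<open>\<Omega>\<close>, onto itself, because in a chart the coordinate transversal
  to \<open>M\<close> satisfies a Gronwall inequality. So the derivative depends on \<open>X\<close> only through
  \<open>X \<bullet> n\<close> on \<open>M\<close> and the values \<open>(X \<bullet> \<nu>)(A)\<close>, \<open>(X \<bullet> \<nu>)(B)\<close>. Since \<open>M\<close> is of class C2, the
  normal has a C1 extension \<open>N\<close>, and C1 functions \<open>f\<close> on \<open>M\<close> have extensions \<open>E f\<close> with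
  \<open>C\<^sup>1\<close> bound and support controlled uniformly in \<open>f\<close>. Then \<open>h f = dJ(\<Omega>)(E f N)\<close>, and
  the two coefficients are the derivatives in the direction of tangential bump fields at the tips.
\<close>

section \<open>Calculus of C1 maps\<close>

text \<open>Vanishing at the tips is essential: a tangential field that is nonzero at a tip moves it
  along the tangent and so lengthens or shortens the crack. This is the origin of the two point
  terms. The extension \<open>E f\<close> is picked by choice for each \<open>f\<close> and need not
  be linear in \<open>f\<close>. Still \<open>h\<close> is linear: the fields built from
  \<open>f + g\<close> on the one hand and from \<open>f\<close> and \<open>g\<close> on the other
  agree on \<open>M\<close>, tips included, and the derivative sees no more of them. What
  \<open>E\<close> must provide is uniformity. Continuity of the derivative at the zero field gives
  one bound by the C1 size of a field, and this passes to \<open>h\<close> only because the C1 size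
  of \<open>E f\<close> is at most a fixed multiple of the norm of \<open>f\<close>. The fields
  \<open>E f N\<close> are normal on \<open>M\<close>, so at a tip they carry no tangential part and
  leave the two coefficients undisturbed.\<close>

lemma C1_onI:
  fixes f :: "'a::euclidean_space \<Rightarrow> 'b::real_normed_vector"
  assumes der: "\<And>x. x \<in> U \<Longrightarrow> (f has_derivative f' x) (at x)"
    and cont: "\<And>h. continuous_on U (\<lambda>x. f' x h)"
  shows "C1_on U f"
  unfolding C1_on_def
proof (intro exI conjI ballI)
  have app: "blinfun_apply (Blinfun (f' x)) = f' x" if "x \<in> U" for x
    using der[OF that] by (simp add: bounded_linear_Blinfun_apply has_derivative_bounded_linear)
  show "(f has_derivative blinfun_apply (Blinfun (f' x))) (at x)" if "x \<in> U" for x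
    using der[OF that] app[OF that] by simp
  \<comment> \<open>In finite dimension, continuity of the derivative in each direction amounts to
    continuity in operator norm. Later proofs can therefore give derivatives as plain
    functions.\<close>
  have "continuous_on U (\<lambda>x. blinfun_apply (Blinfun (f' x)) i)" for i
    using cont[of i] by (rule continuous_on_eq) (simp add: app)
  then show "continuous_on U (\<lambda>x. Blinfun (f' x))"
    by (intro continuous_on_blinfun_componentwise) auto
qed

lemma C1_onE:
  assumes "C1_on U f"
  obtains f' :: "'a::real_normed_vector \<Rightarrow> 'a \<Rightarrow>\<^sub>L 'b::real_normed_vector"
    where "\<And>x. x \<in> U \<Longrightarrow> (f has_derivative blinfun_apply (f' x)) (at x)" "continuous_on U f'"
  using assms unfolding C1_on_def by blast

lemma C1_on_differentiable: "C1_on U f \<Longrightarrow> x \<in> U \<Longrightarrow> f differentiable at x"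
  unfolding C1_on_def differentiable_def by blast

lemma C1_on_has_derivative:
  "C1_on U f \<Longrightarrow> x \<in> U \<Longrightarrow> (f has_derivative frechet_derivative f (at x)) (at x)"
  using C1_on_differentiable frechet_derivative_works by blast

lemma C1_on_continuous_on: "C1_on U f \<Longrightarrow> continuous_on U f"
  by (meson C1_on_has_derivative continuous_at_imp_continuous_on has_derivative_continuous)

lemma frechet_derivative_eq: "(f has_derivative f') (at x) \<Longrightarrow> frechet_derivative f (at x) = f'"
  using frechet_derivative_at by metis

lemma C1_on_continuous_deriv:
  assumes "C1_on U f"
  shows "continuous_on U (\<lambda>x. frechet_derivative f (at x) h)"
proof -
  obtain f' where f': "\<And>x. x \<in> U \<Longrightarrow> (f has_derivative blinfun_apply (f' x)) (at x)" "continuous_on U f'"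
    using C1_onE[OF assms] by blast
  have "continuous_on U (\<lambda>x. blinfun_apply (f' x) h)"
    using f'(2) by (intro continuous_intros)
  then show ?thesis
    by (rule continuous_on_eq) (simp add: frechet_derivative_eq[OF f'(1)])
qed

lemma C1_on_subset: "C1_on U f \<Longrightarrow> V \<subseteq> U \<Longrightarrow> C1_on V f"
  unfolding C1_on_def by (meson continuous_on_subset subsetD)

lemma C1_on_compose:
  fixes f :: "'a::euclidean_space \<Rightarrow> 'b::real_normed_vector"
  assumes g: "C1_on V g" and f: "C1_on U f" and sub: "f ` U \<subseteq> V"
  shows "C1_on U (\<lambda>x. g (f x))"
proof -
  obtain g' where g': "\<And>x. x \<in> V \<Longrightarrow> (g has_derivative blinfun_apply (g' x)) (at x)" "continuous_on V g'"
    using C1_onE[OF g] by blast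
  show ?thesis
  proof (rule C1_onI)
    fix x assume "x \<in> U"
    then show "((\<lambda>x. g (f x)) has_derivative (\<lambda>h. g' (f x) (frechet_derivative f (at x) h))) (at x)"
      using has_derivative_compose[OF C1_on_has_derivative[OF f] g'(1)] sub by blast
  next
    fix h
    have "continuous_on U (\<lambda>x. g' (f x))"
      using continuous_on_compose2[OF g'(2) C1_on_continuous_on[OF f] sub] .
    then show "continuous_on U (\<lambda>x. g' (f x) (frechet_derivative f (at x) h))"
      by (intro continuous_intros C1_on_continuous_deriv[OF f])
  qed
qed

lemma C1_on_bilinear:
  fixes f :: "'a::euclidean_space \<Rightarrow> 'b::real_normed_vector" and g :: "'a \<Rightarrow> 'c::real_normed_vector"
  assumes p: "bounded_bilinear p" and f: "C1_on U f" and g: "C1_on U g"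
  shows "C1_on U (\<lambda>x. p (f x) (g x))"
proof (rule C1_onI)
  fix x assume "x \<in> U"
  then show "((\<lambda>x. p (f x) (g x)) has_derivative
     (\<lambda>h. p (f x) (frechet_derivative g (at x) h) + p (frechet_derivative f (at x) h) (g x))) (at x)"
    using bounded_bilinear.FDERIV[OF p C1_on_has_derivative[OF f] C1_on_has_derivative[OF g]] by simp
next
  fix h
  show "continuous_on U (\<lambda>x. p (f x) (frechet_derivative g (at x) h) + p (frechet_derivative f (at x) h) (g x))"
    by (intro continuous_on_add bounded_bilinear.continuous_on[OF p] C1_on_continuous_deriv
        C1_on_continuous_on f g)
qed

lemmas C1_on_scaleR = C1_on_bilinear[OF bounded_bilinear_scaleR]
lemmas C1_on_mult = C1_on_bilinear[OF bounded_bilinear_mult]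
lemmas C1_on_inner = C1_on_bilinear[OF bounded_bilinear_inner]

lemma C1_on_bounded_linear: 
  fixes f :: "'a::euclidean_space \<Rightarrow> 'b::real_normed_vector"
  assumes "bounded_linear f"
  shows "C1_on U f"
  by (rule C1_onI[where f' = "\<lambda>_. f"]) (auto intro: assms bounded_linear_imp_has_derivative continuous_intros)

lemma C1_on_const: "C1_on U (\<lambda>_::'a::euclidean_space. c)"
  by (rule C1_onI[where f' = "\<lambda>_ _. 0"]) (auto intro: continuous_intros)

lemma C1_on_add:
  fixes f g :: "'a::euclidean_space \<Rightarrow> 'b::real_normed_vector"
  assumes "C1_on U f" "C1_on U g"
  shows "C1_on U (\<lambda>x. f x + g x)"
  by (rule C1_onI[where f' = "\<lambda>x h. frechet_derivative f (at x) h + frechet_derivative g (at x) h"])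
    (auto intro!: has_derivative_add C1_on_has_derivative C1_on_continuous_deriv continuous_on_add assms)

lemma C1_on_diff:
  fixes f g :: "'a::euclidean_space \<Rightarrow> 'b::real_normed_vector"
  assumes "C1_on U f" "C1_on U g"
  shows "C1_on U (\<lambda>x. f x - g x)"
  by (rule C1_onI[where f' = "\<lambda>x h. frechet_derivative f (at x) h - frechet_derivative g (at x) h"])
    (auto intro!: has_derivative_diff C1_on_has_derivative C1_on_continuous_deriv continuous_on_diff assms)

lemma C1_on_vec_nth:
  fixes f :: "'a::euclidean_space \<Rightarrow> real^'n"
  assumes "C1_on U f"
  shows "C1_on U (\<lambda>x. f x $ i)"
  by (rule C1_onI[where f' = "\<lambda>x h. frechet_derivative f (at x) h $ i"])
    (auto intro!: bounded_linear.has_derivative[OF bounded_linear_vec_nth] C1_on_has_derivative 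
       C1_on_continuous_deriv continuous_on_component assms)

lemma C1_on_cong_open:
  assumes f: "C1_on U f" and "open U" and eq: "\<And>x. x \<in> U \<Longrightarrow> f x = g x"
  shows "C1_on U g"
  using f unfolding C1_on_def
  by (metis assms(2) eq has_derivative_transform_within_open)

lemma frechet_derivative_cong_open:
  assumes "C1_on U f" and "open U" and eq: "\<And>x. x \<in> U \<Longrightarrow> f x = g x" and "x \<in> U"
  shows "frechet_derivative g (at x) = frechet_derivative f (at x)"
  using frechet_derivative_eq has_derivative_transform_within_open[OF C1_on_has_derivative[OF assms(1,4)] assms(2,4)] eq
  by metis

lemma C1_on_Un:
  fixes f :: "'a::euclidean_space \<Rightarrow> 'b::real_normed_vector"
  assumes "C1_on U f" "C1_on V f" "open U" "open V"
  shows "C1_on (U \<union> V) f"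
proof (rule C1_onI)
  show "(f has_derivative frechet_derivative f (at x)) (at x)" if "x \<in> U \<union> V" for x
    using that assms(1,2)[THEN C1_on_has_derivative] by blast
  show "continuous_on (U \<union> V) (\<lambda>x. frechet_derivative f (at x) h)" for h
    using assms by (intro continuous_on_open_Un C1_on_continuous_deriv)
qed

lemma C1_on_lipschitz:
  fixes f :: "'a::euclidean_space \<Rightarrow> 'b::real_normed_vector"
  assumes f: "C1_on U f" and K: "compact K" "convex K" "K \<subseteq> U"
  obtains C where "C > 0" "\<And>x y. x \<in> K \<Longrightarrow> y \<in> K \<Longrightarrow> norm (f x - f y) \<le> C * norm (x - y)"
proof -
  obtain f' where f': "\<And>x. x \<in> U \<Longrightarrow> (f has_derivative blinfun_apply (f' x)) (at x)" "continuous_on U f'"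
    using C1_onE[OF f] by blast
  have "bounded (f' ` K)"
    using K f'(2) by (meson compact_continuous_image compact_imp_bounded continuous_on_subset)
  then obtain C where C: "C > 0" "\<And>x. x \<in> K \<Longrightarrow> norm (f' x) \<le> C"
    unfolding bounded_pos by auto
  have "norm (f x - f y) \<le> C * norm (x - y)" if "x \<in> K" "y \<in> K" for x y
  proof (rule differentiable_bound[OF K(2)])
    show "(f has_derivative blinfun_apply (f' x)) (at x within K)" if "x \<in> K" for x
      using f'(1) K that has_derivative_at_withinI by blast
    show "onorm (blinfun_apply (f' x)) \<le> C" if "x \<in> K" for x
      using C(2)[OF that] by (simp add: norm_blinfun.rep_eq)
  qed (use that in auto)
  then show ?thesis using that C by blast
qed

section \<open>C1 maps with explicit bounds on values and derivatives\<close>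

definition C1_bounded_on :: "'a::real_normed_vector set \<Rightarrow> ('a \<Rightarrow> 'b::real_normed_vector) \<Rightarrow> real \<Rightarrow> bool" where
  "C1_bounded_on U f B \<longleftrightarrow> C1_on U f \<and>
     (\<forall>x\<in>U. norm (f x) \<le> B \<and> (\<forall>h. norm (frechet_derivative f (at x) h) \<le> B * norm h))"

lemma C1_bounded_onI:
  fixes f :: "'a::euclidean_space \<Rightarrow> 'b::real_normed_vector"
  assumes "\<And>x. x \<in> U \<Longrightarrow> (f has_derivative f' x) (at x)" "\<And>h. continuous_on U (\<lambda>x. f' x h)"
    "\<And>x. x \<in> U \<Longrightarrow> norm (f x) \<le> B" "\<And>x h. x \<in> U \<Longrightarrow> norm (f' x h) \<le> B * norm h"
  shows "C1_bounded_on U f B"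
  unfolding C1_bounded_on_def using C1_onI[of U f f'] assms
  by (simp add: frechet_derivative_eq[OF assms(1)])

lemma C1_bounded_on_compact:
  assumes "C1_on U f" "compact K" "K \<subseteq> U"
  obtains B where "C1_bounded_on K f B" "B > 0"
proof -
  obtain f' where f': "\<And>x. x \<in> U \<Longrightarrow> (f has_derivative blinfun_apply (f' x)) (at x)" "continuous_on U f'"
    using C1_onE[OF assms(1)] by blast
  have "bounded (f' ` K)"
    using assms f'(2) by (meson compact_continuous_image compact_imp_bounded continuous_on_subset)
  then obtain C where C: "C > 0" "\<And>x. x \<in> K \<Longrightarrow> norm (f' x) \<le> C"
    unfolding bounded_pos by auto
  have "bounded (f ` K)"
    using assms C1_on_continuous_on by (meson compact_continuous_image compact_imp_bounded continuous_on_subset)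
  then obtain C' where C': "C' > 0" "\<And>x. x \<in> K \<Longrightarrow> norm (f x) \<le> C'"
    unfolding bounded_pos by auto
  have "norm (f' x h) \<le> (C + C') * norm h" if "x \<in> K" for x h
  proof -
    have "norm (f' x h) \<le> norm (f' x) * norm h" by (rule norm_blinfun)
    also have "\<dots> \<le> (C + C') * norm h" using C(2)[OF that] C'(1) by (intro mult_right_mono) auto
    finally show ?thesis .
  qed
  moreover have "norm (f x) \<le> C + C'" if "x \<in> K" for x using C'(2)[OF that] C(1) by linarith
  ultimately have "C1_bounded_on K f (C + C')"
    using f' assms unfolding C1_bounded_on_def by (auto simp: frechet_derivative_eq[OF f'(1)] intro: C1_on_subset)
  then show ?thesis using that C C' by force
qed

lemma C1_bounded_on_mono:
  assumes "C1_bounded_on U f B" "V \<subseteq> U" "B \<le> B'"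
  shows "C1_bounded_on V f B'"
  using assms unfolding C1_bounded_on_def
  by (meson C1_on_subset mult_right_mono norm_ge_zero order_trans subsetD)

lemma C1_bounded_on_Un:
  fixes f :: "'a::euclidean_space \<Rightarrow> 'b::real_normed_vector"
  assumes "C1_bounded_on U f B" "C1_bounded_on V f B" "open U" "open V"
  shows "C1_bounded_on (U \<union> V) f B"
  using assms C1_on_Un unfolding C1_bounded_on_def by blast

lemma C1_bounded_on_cong_open:
  assumes f: "C1_bounded_on U f B" and "open U" and eq: "\<And>x. x \<in> U \<Longrightarrow> f x = g x"
  shows "C1_bounded_on U g B"
  using assms C1_on_cong_open[of U f g] frechet_derivative_cong_open[of U f g] unfolding C1_bounded_on_def
  by simp

lemma C1_bounded_on_add:
  fixes f g :: "'a::euclidean_space \<Rightarrow> 'b::real_normed_vector"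
  assumes f: "C1_bounded_on U f B" and g: "C1_bounded_on U g B'"
  shows "C1_bounded_on U (\<lambda>x. f x + g x) (B + B')"
proof (rule C1_bounded_onI)
  let ?D = "\<lambda>x h. frechet_derivative f (at x) h + frechet_derivative g (at x) h"
  show "((\<lambda>x. f x + g x) has_derivative ?D x) (at x)" if "x \<in> U" for x
    using f g that unfolding C1_bounded_on_def by (auto intro!: has_derivative_add C1_on_has_derivative)
  show "continuous_on U (\<lambda>x. ?D x h)" for h
    using f g unfolding C1_bounded_on_def by (auto intro!: continuous_on_add C1_on_continuous_deriv)
  show "norm (f x + g x) \<le> B + B'" if "x \<in> U" for x
    using f g that unfolding C1_bounded_on_def by (intro norm_triangle_mono) auto
  show "norm (?D x h) \<le> (B + B') * norm h" if "x \<in> U" for x h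
    using f g that unfolding C1_bounded_on_def distrib_right by (intro norm_triangle_mono) auto
qed

lemma C1_bounded_on_scaleR:
  fixes f :: "'a::euclidean_space \<Rightarrow> real" and g :: "'a \<Rightarrow> 'b::real_normed_vector"
  assumes f: "C1_bounded_on U f B" and g: "C1_bounded_on U g B'"
  shows "C1_bounded_on U (\<lambda>x. f x *\<^sub>R g x) (2 * B * B')"
proof (rule C1_bounded_onI)
  let ?D = "\<lambda>x h. f x *\<^sub>R frechet_derivative g (at x) h + frechet_derivative f (at x) h *\<^sub>R g x"
  show "((\<lambda>x. f x *\<^sub>R g x) has_derivative ?D x) (at x)" if "x \<in> U" for x
    using f g that unfolding C1_bounded_on_def by (auto intro!: has_derivative_scaleR C1_on_has_derivative)
  show "continuous_on U (\<lambda>x. ?D x h)" for h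
    using f g unfolding C1_bounded_on_def
    by (intro continuous_on_add continuous_on_scaleR C1_on_continuous_deriv C1_on_continuous_on) auto
  fix x assume x: "x \<in> U"
  have *: "\<bar>f x\<bar> \<le> B" "norm (g x) \<le> B'" "\<bar>frechet_derivative f (at x) h\<bar> \<le> B * norm h"
     "norm (frechet_derivative g (at x) h) \<le> B' * norm h" for h
    using f g x unfolding C1_bounded_on_def by auto
  then have nn: "B \<ge> 0" "B' \<ge> 0" by (smt (verit) norm_ge_zero)+
  have "\<bar>f x\<bar> * norm (g x) \<le> B * B'" by (rule mult_mono[OF *(1,2)]) (use nn in auto)
  moreover have "0 \<le> B * B'" using nn by simp
  ultimately show "norm (f x *\<^sub>R g x) \<le> 2 * B * B'" by simp
  fix h
  have "\<bar>f x\<bar> * norm (frechet_derivative g (at x) h) \<le> B * (B' * norm h)"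
    by (rule mult_mono[OF *(1,4)]) (use nn in auto)
  moreover have "\<bar>frechet_derivative f (at x) h\<bar> * norm (g x) \<le> (B * norm h) * B'"
    by (rule mult_mono[OF *(3,2)]) (use nn in auto)
  ultimately have "norm (?D x h) \<le> B * (B' * norm h) + (B * norm h) * B'"
    by (intro norm_triangle_mono) simp_all
  then show "norm (?D x h) \<le> 2 * B * B' * norm h" by (simp add: algebra_simps)
qed

lemma C1_bounded_on_const_scaleR:
  fixes f :: "'a::euclidean_space \<Rightarrow> 'b::real_normed_vector"
  assumes f: "C1_bounded_on U f B"
  shows "C1_bounded_on U (\<lambda>x. c *\<^sub>R f x) (\<bar>c\<bar> * B)"
proof (rule C1_bounded_onI)
  show "((\<lambda>x. c *\<^sub>R f x) has_derivative (\<lambda>h. c *\<^sub>R frechet_derivative f (at x) h)) (at x)" if "x \<in> U" for x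
    using f that unfolding C1_bounded_on_def by (intro has_derivative_scaleR_right C1_on_has_derivative) auto
  show "continuous_on U (\<lambda>x. c *\<^sub>R frechet_derivative f (at x) h)" for h
    using f unfolding C1_bounded_on_def by (intro continuous_intros C1_on_continuous_deriv) auto
  show "norm (c *\<^sub>R f x) \<le> \<bar>c\<bar> * B" if "x \<in> U" for x
    using f that unfolding C1_bounded_on_def by (simp add: mult_left_mono)
  show "norm (c *\<^sub>R frechet_derivative f (at x) h) \<le> \<bar>c\<bar> * B * norm h" if "x \<in> U" for x h
    using f that unfolding C1_bounded_on_def by (simp add: mult_left_mono mult.assoc)
qed

text \<open>Allowing any constant \<open>k\<close> off \<open>K\<close>, and not only 0, covers a
  cutoff \<open>c\<close> and its complement \<open>1 - c\<close> alike.\<close>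

lemma C1_bounded_on_UNIV:
  fixes f :: "'a::euclidean_space \<Rightarrow> 'b::real_normed_vector"
  assumes f: "C1_on UNIV f" and K: "compact K" and const: "\<And>x. x \<notin> K \<Longrightarrow> f x = k"
  obtains B where "C1_bounded_on UNIV f B" "B > 0"
proof -
  obtain B where B: "C1_bounded_on K f B" "B > 0"
    using C1_bounded_on_compact[OF f K] by auto
  have "C1_bounded_on (- K) f (B + norm k)"
  proof (rule C1_bounded_on_cong_open)
    show "C1_bounded_on (- K) (\<lambda>_. k) (B + norm k)"
      by (rule C1_bounded_onI[where f' = "\<lambda>_ _. 0"]) (use B in auto)
    show "open (- K)" using K by (simp add: compact_imp_closed open_Compl)
  qed (use const in auto)
  moreover have "C1_bounded_on K f (B + norm k)" by (rule C1_bounded_on_mono[OF B(1)]) auto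
  ultimately have "C1_bounded_on UNIV f (B + norm k)"
    using f unfolding C1_bounded_on_def by blast
  then show ?thesis using B(2) that[of "B + norm k"] by (simp add: add_pos_nonneg)
qed

section \<open>C1 functions for normalisation and cutoffs\<close>

lemma C1_on_inverse_sqrt: "C1_on {0<..} (\<lambda>t::real. inverse (sqrt t))"
proof (rule C1_onI)
  fix t :: real assume t: "t \<in> {0<..}"
  have "((\<lambda>t. inverse (sqrt t)) has_real_derivative - (inverse (sqrt t) * (inverse (sqrt t) / 2) * inverse (sqrt t))) (at t)"
    using t by (auto intro!: derivative_eq_intros)
  then show "((\<lambda>t. inverse (sqrt t)) has_derivative (\<lambda>h. - (inverse (sqrt t) * (inverse (sqrt t) / 2) * inverse (sqrt t)) * h)) (at t)"
    unfolding has_field_derivative_def .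
next
  fix h :: real
  show "continuous_on {0<..} (\<lambda>t. - (inverse (sqrt t) * (inverse (sqrt t) / 2) * inverse (sqrt t)) * h)"
    by (intro continuous_intros) auto
qed

text \<open>Squaring removes the kink of the positive part at 0. The result is an elementary C1
  function that is flat on a half-line, from which cutoffs are composed.\<close>

lemma C1_on_pos_part_sq: "C1_on U (\<lambda>t::real. (max 0 t)\<^sup>2)"
proof (rule C1_onI)
  fix t :: real
  have "((\<lambda>t::real. (max 0 t)\<^sup>2) has_real_derivative 2 * max 0 t) (at t)"
  proof (cases t "0::real" rule: linorder_cases)
    case less
    have "((\<lambda>t::real. 0) has_real_derivative 2 * max 0 t) (at t)" using less by simp
    then show ?thesis
      by (rule DERIV_cong_ev[THEN iffD1, rotated -1, OF _ refl _ refl])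
         (use less in \<open>auto intro!: eventually_mono[OF eventually_nhds_in_open[of "{..<0}"]]\<close>)
  next
    case greater
    have "((\<lambda>t::real. t\<^sup>2) has_real_derivative 2 * max 0 t) (at t)"
      using greater by (auto intro!: derivative_eq_intros)
    then show ?thesis
      by (rule DERIV_cong_ev[THEN iffD1, rotated -1, OF _ refl _ refl])
         (use greater in \<open>auto intro!: eventually_mono[OF eventually_nhds_in_open[of "{0<..}"]]\<close>)
  next
    case equal
    have "((\<lambda>h::real. (max 0 h)\<^sup>2 / h) \<longlongrightarrow> 0) (at 0)"
    proof (rule Lim_null_comparison)
      show "\<forall>\<^sub>F h::real in at 0. norm ((max 0 h)\<^sup>2 / h) \<le> \<bar>h\<bar>"
        by (intro always_eventually allI) (auto simp: max_def power2_eq_square)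
      show "((\<lambda>h::real. \<bar>h\<bar>) \<longlongrightarrow> 0) (at 0)" by (auto intro!: tendsto_eq_intros)
    qed
    then show ?thesis using equal by (simp add: DERIV_def)
  qed
  then show "((\<lambda>t::real. (max 0 t)\<^sup>2) has_derivative (\<lambda>h. (2 * max 0 t) * h)) (at t)"
    by (simp add: has_field_derivative_def)
qed (intro continuous_intros)

lemma C1_cutoff:
  fixes p :: "'a::euclidean_space"
  assumes "0 < r" "r < R"
  obtains c :: "'a \<Rightarrow> real" where "C1_on UNIV c" "\<And>x. dist p x \<le> r \<Longrightarrow> c x = 1" "\<And>x. dist p x \<ge> R \<Longrightarrow> c x = 0"
proof
  define k where "k = (\<lambda>t::real. (max 0 t)\<^sup>2)"
  define u where "u = (\<lambda>x. R\<^sup>2 - (x - p) \<bullet> (x - p))"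
  \<comment> \<open>The inner \<open>k\<close> makes the function vanish beyond radius
    \<open>R\<close>; the outer one flattens it to 1 within radius \<open>r\<close>, where the
    quotient is at least 1. Using the squared distance in \<open>u\<close> avoids the singularity of
    the norm at \<open>p\<close>.\<close>
  define c where "c = (\<lambda>x. 1 - k (1 - k (u x) / k (R\<^sup>2 - r\<^sup>2)))"
  have k: "C1_on UNIV k" unfolding k_def by (rule C1_on_pos_part_sq)
  have id: "C1_on UNIV (\<lambda>x. x :: 'a)" by (intro C1_on_bounded_linear bounded_linear_ident)
  have "C1_on UNIV u" unfolding u_def
    by (intro C1_on_diff C1_on_inner C1_on_const id)
  then have "C1_on UNIV (\<lambda>x. k (u x))" using C1_on_compose[OF k] by blast
  then have "C1_on UNIV (\<lambda>x. 1 - inverse (k (R\<^sup>2 - r\<^sup>2)) * k (u x))"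
    by (intro C1_on_diff C1_on_mult C1_on_const)
  then have "C1_on UNIV (\<lambda>x. k (1 - inverse (k (R\<^sup>2 - r\<^sup>2)) * k (u x)))" using C1_on_compose[OF k] by blast
  then have "C1_on UNIV (\<lambda>x. 1 - k (1 - inverse (k (R\<^sup>2 - r\<^sup>2)) * k (u x)))"
    by (intro C1_on_diff C1_on_const)
  then show "C1_on UNIV c" unfolding c_def by (simp add: divide_inverse mult.commute)
  have u: "u x = R\<^sup>2 - (dist p x)\<^sup>2" for x
    by (simp add: u_def dist_norm power2_norm_eq_inner inner_diff inner_commute)
  have rR: "r\<^sup>2 < R\<^sup>2" using assms by (simp add: power_strict_mono)
  show "c x = 1" if "dist p x \<le> r" for x
  proof -
    have "(dist p x)\<^sup>2 \<le> r\<^sup>2" using that by (simp add: power_mono)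
    then have "k (u x) \<ge> k (R\<^sup>2 - r\<^sup>2)" "k (R\<^sup>2 - r\<^sup>2) > 0"
      using rR unfolding k_def u by (auto simp: max_def intro!: power_mono)
    then show ?thesis by (simp add: c_def k_def max_def)
  qed
  show "c x = 0" if "dist p x \<ge> R" for x
  proof -
    have "(dist p x)\<^sup>2 \<ge> R\<^sup>2" using that assms by (simp add: power_mono)
    then show ?thesis by (simp add: c_def k_def u)
  qed
qed

section \<open>Flows\<close>

text \<open>The bound makes \<open>w s * exp (- K * s)\<close> nonincreasing and
  \<open>w s * exp (K * s)\<close> nondecreasing. Comparing the values at \<open>t0\<close> and
  \<open>t\<close> with the first forwards and the second backwards forces
  \<open>w t \<le> 0\<close>.\<close>

lemma gronwall_zero:
  fixes w :: "real \<Rightarrow> real"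
  assumes der: "\<And>s. s \<in> closed_segment t0 t \<Longrightarrow> (w has_real_derivative w' s) (at s)"
    and bnd: "\<And>s. s \<in> closed_segment t0 t \<Longrightarrow> \<bar>w' s\<bar> \<le> K * w s"
    and "w t0 = 0" "w t \<ge> 0"
  shows "w t = 0"
proof (cases "t0 \<le> t")
  case True
  have "w t * exp (- K * t) \<le> w t0 * exp (- K * t0)"
  proof (rule DERIV_nonpos_imp_nonincreasing[OF True])
    fix s assume "t0 \<le> s" "s \<le> t"
    then have s: "s \<in> closed_segment t0 t" by (simp add: closed_segment_eq_real_ivl)
    have "((\<lambda>s. w s * exp (- K * s)) has_real_derivative (w' s - K * w s) * exp (- K * s)) (at s)"
      by (auto intro!: derivative_eq_intros der[OF s] simp: algebra_simps)
    moreover have "(w' s - K * w s) * exp (- K * s) \<le> 0"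
      using bnd[OF s] by (intro mult_nonpos_nonneg) auto
    ultimately show "\<exists>y. ((\<lambda>s. w s * exp (- K * s)) has_real_derivative y) (at s) \<and> y \<le> 0" by blast
  qed
  then show ?thesis using assms(3,4) by (simp add: mult_le_0_iff)
next
  case False
  have "w t * exp (K * t) \<le> w t0 * exp (K * t0)"
  proof (rule DERIV_nonneg_imp_nondecreasing[where f = "\<lambda>s. w s * exp (K * s)"])
    show "t \<le> t0" using False by simp
    fix s assume "t \<le> s" "s \<le> t0"
    then have s: "s \<in> closed_segment t0 t" by (simp add: closed_segment_eq_real_ivl)
    have "((\<lambda>s. w s * exp (K * s)) has_real_derivative (w' s + K * w s) * exp (K * s)) (at s)"
      by (auto intro!: derivative_eq_intros der[OF s] simp: algebra_simps)
    moreover have "(w' s + K * w s) * exp (K * s) \<ge> 0"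
      using bnd[OF s] by (intro mult_nonneg_nonneg) auto
    ultimately show "\<exists>y. ((\<lambda>s. w s * exp (K * s)) has_real_derivative y) (at s) \<and> 0 \<le> y" by blast
  qed
  then show ?thesis using assms(3,4) by (simp add: mult_le_0_iff)
qed

text \<open>Gronwall is applied to the squared distance, which is differentiable even where the
  solutions meet; squaring doubles the Lipschitz constant.\<close>

lemma ode_unique:
  fixes X :: "'a::real_inner \<Rightarrow> 'a"
  assumes lip: "\<And>x y. norm (X x - X y) \<le> K * norm (x - y)"
    and u: "\<And>t. (u has_vector_derivative X (u t)) (at t)"
    and v: "\<And>t. (v has_vector_derivative X (v t)) (at t)"
    and "u t0 = v t0"
  shows "u t = v t"
proof -
  define w where "w = (\<lambda>t. (u t - v t) \<bullet> (u t - v t))"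
  have "w t = 0"
  proof (rule gronwall_zero[where ?t0.0 = t0 and t = t and w = w and K = "2 * K" and w' = "\<lambda>t. 2 * ((u t - v t) \<bullet> (X (u t) - X (v t)))"])
    fix s
    have d: "((\<lambda>t. u t - v t) has_derivative (\<lambda>h. h *\<^sub>R (X (u s) - X (v s)))) (at s)"
      using has_vector_derivative_diff[OF u v] by (simp add: has_vector_derivative_def)
    show "(w has_real_derivative 2 * ((u s - v s) \<bullet> (X (u s) - X (v s)))) (at s)"
      unfolding w_def has_field_derivative_def
      by (rule has_derivative_eq_rhs[OF has_derivative_inner[OF d d]])
        (auto simp: fun_eq_iff inner_commute algebra_simps)
    have "\<bar>(u s - v s) \<bullet> (X (u s) - X (v s))\<bar> \<le> norm (u s - v s) * (K * norm (u s - v s))"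
      using Cauchy_Schwarz_ineq2 lip by (meson mult_left_mono norm_ge_zero order_trans)
    then show "\<bar>2 * ((u s - v s) \<bullet> (X (u s) - X (v s)))\<bar> \<le> 2 * K * w s"
      by (simp add: w_def dot_square_norm power2_eq_square abs_mult mult_ac)
  qed (use assms in \<open>auto simp: w_def\<close>)
  then show ?thesis by (simp add: w_def)
qed

section \<open>Global existence of solutions\<close>

lemma integral_upper_has_vector_derivative:
  fixes g :: "real \<Rightarrow> 'a::banach"
  assumes "continuous_on UNIV g" "t \<ge> 0"
  shows "((\<lambda>t. integral {0..t} g) has_vector_derivative g t) (at t within {0..})"
proof -
  have "((\<lambda>t. integral {0..t} g) has_vector_derivative g t) (at t within {0..t+1})"
    using assms by (intro integral_has_vector_derivative) (auto intro: continuous_on_subset)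
  moreover have "at t within {0..t+1} = at t within {0..}"
    by (rule at_within_nhd[where S = "{..<t+1}"]) auto
  ultimately show ?thesis by simp
qed

text \<open>The Picard operator is a contraction for the norm weighted by \<open>exp (- l * t)\<close>, which
  yields the solution for all nonnegative times at once.\<close>

lemma picard_forward:
  fixes X :: "'a::euclidean_space \<Rightarrow> 'a"
  assumes lip: "\<And>x y. norm (X x - X y) \<le> K * norm (x - y)" and bnd: "\<And>x. norm (X x) \<le> B"
  obtains u where "u 0 = x" "\<And>t. t \<ge> 0 \<Longrightarrow> (u has_vector_derivative X (u t)) (at t within {0..})"
proof -
  have K: "K \<ge> 0"
  proof -
    obtain b :: 'a where b: "b \<in> Basis" using nonempty_Basis by blast
    have "0 \<le> K * norm (b - 0)" using lip[of b 0] norm_ge_zero order_trans by blast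
    then show ?thesis using b by simp
  qed
  have B: "B \<ge> 0" using bnd norm_ge_zero order_trans by blast
  \<comment> \<open>With this weight the contraction factor \<open>K / l\<close> is at most 1/2, and
    \<open>l\<close> is positive even if \<open>K = 0\<close>.\<close>
  define l where "l = 2 * K + 1"
  have l: "l > 0" "K / l \<le> 1/2" using K by (auto simp: l_def field_simps)
  have contX: "continuous_on UNIV X"
    by (rule lipschitz_on_continuous_on[of K], rule lipschitz_onI) (auto simp: dist_norm lip K)
  \<comment> \<open>The unknown \<open>z\<close> is the weighted deviation: the solution is sought
    as \<open>x + exp (l * s) *\<^sub>R z s\<close>. Then the weighted norm of the deviation is the
    sup norm of \<open>z\<close>, and bounded continuous functions form a complete space.\<close>
  define g where "g z s = X (x + exp (l * s) *\<^sub>R apply_bcontfun z s)" for z :: "real \<Rightarrow>\<^sub>C 'a" and s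
  define G where "G z t = integral {0..t} (g z)" for z t
  \<comment> \<open>Elements of the Banach space live on the whole line; \<open>max 0 t\<close>
    continues the operator constantly to negative times.\<close>
  define F where "F z t = exp (- l * max 0 t) *\<^sub>R G z (max 0 t)" for z t
  have contg: "continuous_on S (g z)" for z S
    unfolding g_def by (intro continuous_on_compose2[OF contX] continuous_intros) auto
  have intg: "g z integrable_on {0..t}" for z t
    using contg by (rule integrable_continuous_real)
  have G': "(G z has_vector_derivative g z t) (at t within {0..})" if "t \<ge> 0" for z t
    unfolding G_def using integral_upper_has_vector_derivative[OF contg that] .
  have contG: "continuous_on {0..} (G z)" for z
    using G' by (auto simp: continuous_on_eq_continuous_within intro: has_vector_derivative_continuous)
  have contF: "continuous_on UNIV (F z)" for z
  proof -
    have "continuous_on UNIV (\<lambda>t. G z (max 0 t))"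
      by (rule continuous_on_compose2[OF contG]) (auto intro!: continuous_intros)
    then show ?thesis unfolding F_def by (intro continuous_intros)
  qed
  have Fbnd: "norm (F z t) \<le> B / l" for z t
  proof -
    define s where "s = max 0 t"
    have s: "s \<ge> 0" by (simp add: s_def)
    \<comment> \<open>The integral of a field bounded by \<open>B\<close> grows at most linearly,
      and the weight absorbs this: so \<open>F z\<close> is bounded by \<open>B / l\<close>,
      whatever \<open>z\<close> is.\<close>
    have ls: "l * s \<le> exp (l * s)"
      using exp_ge_add_one_self[of "l * s"] by linarith
    have "norm (G z s) \<le> B * (s - 0)"
      unfolding G_def
      by (rule integral_bound[OF s contg]) (simp add: g_def bnd)
    also have "B * (s - 0) \<le> B * (exp (l * s) / l)"
      using ls l B by (intro mult_left_mono) (simp_all add: pos_le_divide_eq mult.commute[of s l])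
    finally have "exp (- l * s) * norm (G z s) \<le> exp (- l * s) * (B * (exp (l * s) / l))"
      by (intro mult_left_mono) auto
    also have "\<dots> = B / l" by (simp add: exp_minus field_simps)
    finally show ?thesis by (simp add: F_def s_def)
  qed
  have Fb: "F z \<in> bcontfun" for z using contF Fbnd by (rule bcontfun_normI)
  define T where "T z = Bcontfun (F z)" for z
  have T: "apply_bcontfun (T z) = F z" for z using Fb by (simp add: T_def Bcontfun_inverse)
  have contr: "dist (T z) (T w) \<le> 1/2 * dist z w" for z w
  proof (rule dist_bound)
    fix t :: real
    define s where "s = max 0 t"
    have s: "s \<ge> 0" by (simp add: s_def)
    define d where "d = dist z w"
    have d: "d \<ge> 0" by (simp add: d_def)
    have e: "((\<lambda>r. K * d * exp (l * r)) has_integral K * d * exp (l * s) / l - K * d * exp (l * 0) / l) {0..s}"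
      by (rule fundamental_theorem_of_calculus[OF s])
        (use l in \<open>auto simp: has_real_derivative_iff_has_vector_derivative[symmetric] intro!: derivative_eq_intros\<close>)
    have "norm (G z s - G w s) = norm (integral {0..s} (\<lambda>r. g z r - g w r))"
      unfolding G_def by (simp add: integral_diff intg)
    also have "\<dots> \<le> integral {0..s} (\<lambda>r. K * d * exp (l * r))"
    proof (rule integral_norm_bound_integral)
      fix r
      have "norm (g z r - g w r) \<le> K * norm (exp (l * r) *\<^sub>R (apply_bcontfun z r - apply_bcontfun w r))"
        unfolding g_def using lip[of "x + exp (l * r) *\<^sub>R apply_bcontfun z r" "x + exp (l * r) *\<^sub>R apply_bcontfun w r"]
        by (simp add: algebra_simps)
      also have "\<dots> \<le> K * (exp (l * r) * d)"
        using K dist_bounded[of z r w] by (intro mult_left_mono) (auto simp: d_def dist_norm)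
      finally show "norm (g z r - g w r) \<le> K * d * exp (l * r)" by (simp add: mult_ac)
    qed (use e intg in \<open>auto intro!: integrable_diff\<close>)
    also have "\<dots> \<le> K * d * exp (l * s) / l"
      unfolding integral_unique[OF e] using l K d by simp
    finally have "exp (- l * s) * norm (G z s - G w s) \<le> exp (- l * s) * (K * d * exp (l * s) / l)"
      by (intro mult_left_mono) auto
    also have "\<dots> = K / l * d" by (simp add: exp_minus field_simps)
    also have "\<dots> \<le> 1/2 * d" using l d by (intro mult_right_mono) auto
    finally have "norm (F z t - F w t) \<le> 1/2 * d"
      by (simp add: F_def s_def scaleR_diff_right[symmetric])
    then show "dist (apply_bcontfun (T z) t) (apply_bcontfun (T w) t) \<le> 1/2 * dist z w"
      by (simp add: T d_def dist_norm)
  qed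
  obtain z where z: "T z = z"
    using banach_fix_type[of "1/2" T] contr by auto
  define u where "u t = x + exp (l * t) *\<^sub>R apply_bcontfun z t" for t
  have u: "u t = x + G z t" if "t \<ge> 0" for t
  proof -
    have "apply_bcontfun z t = exp (- l * t) *\<^sub>R G z t"
      using T[of z] z that by (simp add: F_def)
    then show ?thesis by (simp add: u_def exp_minus)
  qed
  show ?thesis
  proof
    show "u 0 = x" using u[of 0] by (simp add: G_def)
    fix t :: real assume t: "t \<ge> 0"
    have "((\<lambda>t. x + G z t) has_vector_derivative X (u t)) (at t within {0..})"
      using has_vector_derivative_add[OF has_vector_derivative_const G'[OF t]] 
      by (simp add: g_def u_def)
    then show "(u has_vector_derivative X (u t)) (at t within {0..})"
      by (rule has_vector_derivative_transform[rotated 2]) (use u t in auto)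
  qed
qed

lemma has_vector_derivative_within_Un:
  assumes "(f has_vector_derivative D) (at x within S)" "(f has_vector_derivative D) (at x within T)"
  shows "(f has_vector_derivative D) (at x within S \<union> T)"
  using assms unfolding has_vector_derivative_def has_derivative_within
  by (auto simp: Lim_within_Un)

text \<open>Past times come from the forward solution for \<open>- X\<close>, run backwards. At time
  0 the one-sided derivatives of the two pieces agree, so they glue to one solution on the
  line.\<close>

lemma flow_exists:
  fixes X :: "real^2 \<Rightarrow> real^2"
  assumes lip: "\<And>x y. norm (X x - X y) \<le> K * norm (x - y)" and bnd: "\<And>x. norm (X x) \<le> B"
  shows "\<exists>\<Phi>. is_flow X \<Phi>"
proof -
  have "\<exists>u. u 0 = x \<and> (\<forall>t. (u has_vector_derivative X (u t)) (at t))" for x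
  proof -
    obtain u where u: "u 0 = x" "\<And>t. t \<ge> 0 \<Longrightarrow> (u has_vector_derivative X (u t)) (at t within {0..})"
      using picard_forward[OF lip bnd] by metis
    have "norm (- X x - - X y) \<le> K * norm (x - y)" for x y
      using lip by (metis minus_diff_minus norm_minus_cancel)
    then obtain v where v: "v 0 = x" "\<And>t. t \<ge> 0 \<Longrightarrow> (v has_vector_derivative - X (v t)) (at t within {0..})"
      using picard_forward[of "\<lambda>x. - X x" K B x] bnd by auto
    define w where "w t = (if t \<ge> 0 then u t else v (- t))" for t
    have w0: "w 0 = x" by (simp add: w_def u)
    have right: "(w has_vector_derivative X (w t)) (at t within {0..})" if t: "t \<ge> 0" for t
      using has_vector_derivative_transform[OF _ _ u(2)[OF t], of w] t by (auto simp: w_def)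
    have left: "(w has_vector_derivative X (w t)) (at t within {..0})" if t: "t \<le> 0" for t
    proof -
      have "(v has_vector_derivative - X (v (- t))) (at (- t) within uminus ` {..0})"
        using v(2)[of "- t"] t by simp
      moreover have "((\<lambda>t. - t) has_vector_derivative -1) (at t within {..0})"
        by (auto intro!: derivative_eq_intros)
      ultimately have "((v \<circ> uminus) has_vector_derivative X (v (- t))) (at t within {..0})"
        using vector_diff_chain_within[of uminus "-1" t "{..0}" v "- X (v (- t))"] by simp
      then show ?thesis
        using has_vector_derivative_transform[of t "{..0}" w "v \<circ> uminus"] t
        by (auto simp: w_def u v)
    qed
    have "(w has_vector_derivative X (w t)) (at t)" for t
    proof (cases t "0::real" rule: linorder_cases)
      case less
      then show ?thesis using left[of t] at_within_interior[of t "{..0}"] by auto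
    next
      case greater
      then show ?thesis using right[of t] at_within_interior[of t "{0..}"] by auto
    next
      case equal
      have "{..0} \<union> {0..} = (UNIV :: real set)" by auto
      then show ?thesis using has_vector_derivative_within_Un[OF left right, of t] equal by simp
    qed
    then show ?thesis using w0 by blast
  qed
  then obtain U where "\<And>x. U x 0 = x" "\<And>x t. (U x has_vector_derivative X (U x t)) (at t)" by metis
  then have "is_flow X (\<lambda>t x. U x t)" by (simp add: is_flow_def)
  then show ?thesis by blast
qed

section \<open>The flow of a bounded Lipschitz field\<close>

locale lipschitz_field =
  fixes X :: "real^2 \<Rightarrow> real^2" and K B
  assumes lip: "\<And>x y. norm (X x - X y) \<le> K * norm (x - y)" and bnd: "\<And>x. norm (X x) \<le> B"
begin

lemma is_flow_flow: "is_flow X (flow X)"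
  unfolding flow_def
proof (rule theI'[of "is_flow X"])
  show "\<exists>!\<Phi>. is_flow X \<Phi>"
  proof (rule ex_ex1I)
    show "\<exists>\<Phi>. is_flow X \<Phi>" using flow_exists[OF lip bnd] .
    fix \<Phi> \<Psi> assume "is_flow X \<Phi>" "is_flow X \<Psi>"
    then have "\<Phi> t x = \<Psi> t x" for t x
      using ode_unique[OF lip, of "\<lambda>t. \<Phi> t x" "\<lambda>t. \<Psi> t x" 0 t] by (simp add: is_flow_def)
    then show "\<Phi> = \<Psi>" by (simp add: fun_eq_iff)
  qed
qed

lemma flow_0: "flow X 0 x = x"
  using is_flow_flow by (simp add: is_flow_def)

lemma flow_deriv: "((\<lambda>s. flow X s x) has_vector_derivative X (flow X t x)) (at t)"
  using is_flow_flow by (simp add: is_flow_def)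

lemma flow_add: "flow X s (flow X t x) = flow X (s + t) x"
proof (rule ode_unique[OF lip, where ?t0.0 = 0 and u = "\<lambda>s. flow X s (flow X t x)" and v = "\<lambda>s. flow X (s + t) x"])
  show "((\<lambda>s. flow X s (flow X t x)) has_vector_derivative X (flow X s (flow X t x))) (at s)" for s
    by (rule flow_deriv)
  show "((\<lambda>s. flow X (s + t) x) has_vector_derivative X (flow X (s + t) x)) (at s)" for s
  proof -
    have "((\<lambda>s. s + t) has_vector_derivative 1) (at s)"
      by (auto intro!: derivative_eq_intros)
    then show ?thesis
      using vector_diff_chain_at[OF _ flow_deriv, of "\<lambda>s. s + t" 1 s x] by (simp add: o_def)
  qed
qed (simp add: flow_0)

lemma flow_inverse: "flow X (- t) (flow X t x) = x"
  by (simp add: flow_add flow_0)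

lemma flow_zero: "X (flow X t0 x) = 0 \<Longrightarrow> flow X t x = flow X t0 x"
  by (rule ode_unique[OF lip, where ?t0.0 = t0 and u = "\<lambda>t. flow X t x" and v = "\<lambda>_. flow X t0 x"])
    (auto intro: flow_deriv)

text \<open>Invariance is asked for at all real times, and the map at time \<open>- t\<close>
  inverts the map at time \<open>t\<close>; hence inclusion becomes equality.\<close>

lemma flow_image_eq:
  assumes "\<And>t x. x \<in> S \<Longrightarrow> flow X t x \<in> S"
  shows "flow X t ` S = S"
proof
  show "flow X t ` S \<subseteq> S" using assms by blast
  show "S \<subseteq> flow X t ` S"
  proof
    fix x assume "x \<in> S"
    then have "flow X (- t) x \<in> S" "x = flow X t (flow X (- t) x)"
      using assms flow_inverse[of "- t"] by auto
    then show "x \<in> flow X t ` S" by blast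
  qed
qed

end

lemma C1c_bounded:
  assumes "X \<in> C1c D"
  obtains B where "C1_bounded_on UNIV X B" "B > 0"
proof (rule C1_bounded_on_UNIV)
  show "C1_on UNIV X" "compact (closure {x. X x \<noteq> 0})" using assms by (auto simp: C1c_def)
  show "X x = 0" if "x \<notin> closure {x. X x \<noteq> 0}" for x
    using that closure_subset[of "{x. X x \<noteq> 0}"] by (auto simp: subset_iff)
qed (rule that)

lemma C1c_lipschitz_field:
  assumes "X \<in> C1c D"
  obtains K B where "lipschitz_field X K B"
proof -
  obtain B where B: "C1_bounded_on UNIV X B" "B > 0" using C1c_bounded[OF assms] .
  have "norm (X x - X y) \<le> B * norm (x - y)" for x y
  proof (rule differentiable_bound[of UNIV])
    show "(X has_derivative frechet_derivative X (at x)) (at x)" for x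
      using B C1_on_has_derivative unfolding C1_bounded_on_def by blast
    show "onorm (frechet_derivative X (at x)) \<le> B" for x
      using B unfolding C1_bounded_on_def by (intro onorm_bound) auto
  qed auto
  then have "lipschitz_field X B B"
    using B unfolding C1_bounded_on_def by unfold_locales auto
  then show ?thesis by (rule that)
qed

section \<open>Charts and tangent lines\<close>

text \<open>The existential chart notions are unpacked once, with the derivatives as maps
  \<open>\<phi>'\<close> and \<open>\<psi>'\<close> that are themselves C1. This is where class C2
  stays available.\<close>

locale chart =
  fixes M U V :: "(real^2) set" and \<phi> \<psi> :: "real^2 \<Rightarrow> real^2"
    and \<phi>' \<psi>' :: "real^2 \<Rightarrow> (real^2) \<Rightarrow>\<^sub>L (real^2)"
  assumes chart: "submanifold_chart M U V \<phi>"
    and open_U: "open U" and open_V: "open V"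
    and \<phi>_in: "x \<in> U \<Longrightarrow> \<phi> x \<in> V" and \<psi>_in: "y \<in> V \<Longrightarrow> \<psi> y \<in> U"
    and \<psi>_\<phi>: "x \<in> U \<Longrightarrow> \<psi> (\<phi> x) = x" and \<phi>_\<psi>: "y \<in> V \<Longrightarrow> \<phi> (\<psi> y) = y"
    and \<phi>_deriv: "x \<in> U \<Longrightarrow> (\<phi> has_derivative \<phi>' x) (at x)" and \<phi>'_C1: "C1_on U \<phi>'"
    and \<psi>_deriv: "y \<in> V \<Longrightarrow> (\<psi> has_derivative \<psi>' y) (at y)" and \<psi>'_C1: "C1_on V \<psi>'"
    and M_iff: "x \<in> U \<Longrightarrow> x \<in> M \<longleftrightarrow> \<phi> x $ 1 \<ge> 0 \<and> \<phi> x $ 2 = 0"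

lemma submanifold_chartE:
  assumes "submanifold_chart M U V \<phi>"
  obtains \<phi>' \<psi>' where "chart M U V \<phi> (inv_into U \<phi>) \<phi>' \<psi>'"
proof -
  have op: "open U" "open V" and bij: "bij_betw \<phi> U V"
    and C2: "C2_on U \<phi>" "C2_on V (inv_into U \<phi>)"
    and im: "\<phi> ` (U \<inter> M) = V \<inter> {y. y $ 1 \<ge> 0 \<and> y $ 2 = 0}"
    using assms by (auto simp: submanifold_chart_def C2_diffeo_def)
  obtain \<phi>' \<psi>' where d: "\<forall>x\<in>U. (\<phi> has_derivative blinfun_apply (\<phi>' x)) (at x)" "C1_on U \<phi>'"
     "\<forall>x\<in>V. (inv_into U \<phi> has_derivative blinfun_apply (\<psi>' x)) (at x)" "C1_on V \<psi>'"
    using C2 unfolding C2_on_def by blast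
  have iff: "x \<in> M \<longleftrightarrow> \<phi> x $ 1 \<ge> 0 \<and> \<phi> x $ 2 = 0" if x: "x \<in> U" for x
  proof
    assume "x \<in> M"
    then have "\<phi> x \<in> \<phi> ` (U \<inter> M)" using x by blast
    then show "\<phi> x $ 1 \<ge> 0 \<and> \<phi> x $ 2 = 0" unfolding im by blast
  next
    assume "\<phi> x $ 1 \<ge> 0 \<and> \<phi> x $ 2 = 0"
    then have "\<phi> x \<in> \<phi> ` (U \<inter> M)" unfolding im using x bij bij_betwE by blast
    then obtain y where "y \<in> U" "y \<in> M" "\<phi> x = \<phi> y" by blast
    then show "x \<in> M" using bij x by (metis bij_betw_imp_inj_on inj_onD)
  qed
  have "chart M U V \<phi> (inv_into U \<phi>) \<phi>' \<psi>'"
    using assms op bij d iff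
    by unfold_locales
      (auto intro: bij_betwE[OF bij, rule_format] bij_betw_inv_into_left bij_betw_inv_into_right
          bij_betwE[OF bij_betw_inv_into[OF bij], rule_format])
  then show ?thesis by (rule that)
qed

context chart
begin

lemma frechet_\<phi>: "x \<in> U \<Longrightarrow> frechet_derivative \<phi> (at x) = \<phi>' x"
  using frechet_derivative_eq[OF \<phi>_deriv] .

lemma \<phi>_C1: "C1_on U \<phi>" and \<psi>_C1: "C1_on V \<psi>"
  using \<phi>_deriv C1_on_continuous_on[OF \<phi>'_C1] \<psi>_deriv C1_on_continuous_on[OF \<psi>'_C1]
  unfolding C1_on_def by blast+

lemma \<phi>'_\<psi>': assumes "y \<in> V" shows "\<phi>' (\<psi> y) (\<psi>' y h) = h"
proof -
  have "((\<lambda>x. \<phi> (\<psi> x)) has_derivative (\<lambda>h. \<phi>' (\<psi> y) (\<psi>' y h))) (at y)"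
    using has_derivative_compose[OF \<psi>_deriv \<phi>_deriv] assms \<psi>_in by blast
  then have "((\<lambda>x. x) has_derivative (\<lambda>h. \<phi>' (\<psi> y) (\<psi>' y h))) (at y)"
    by (rule has_derivative_transform_within_open[OF _ open_V assms]) (rule \<phi>_\<psi>)
  from has_derivative_unique[OF this has_derivative_ident] show ?thesis by metis
qed

lemma tangent_spaceI: "x \<in> U \<Longrightarrow> \<phi>' x v $ 2 = 0 \<Longrightarrow> v \<in> tangent_space M x"
  unfolding tangent_space_def using chart frechet_\<phi> by force

end

text \<open>The quarter turn. With a unit normal \<open>n x\<close>, the pair \<open>n x\<close>,
  \<open>rot (n x)\<close> is an orthonormal frame whose second member spans the tangent
  line.\<close>

definition rot :: "real^2 \<Rightarrow> real^2" where "rot v = (\<chi> i. if i = 1 then - v $ 2 else v $ 1)"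

lemma rot_nth: "rot v $ 1 = - v $ 2" "rot v $ 2 = v $ 1"
  by (auto simp: rot_def)

lemma inner_2: "v \<bullet> w = v $ 1 * w $ 1 + v $ 2 * w $ 2" for v w :: "real^2"
  by (simp add: inner_vec_def sum_2)

lemma rot_orth: "rot v \<bullet> v = 0" "v \<bullet> rot v = 0"
  by (simp_all add: inner_2 rot_nth)

lemma rot_inner_rot: "rot v \<bullet> rot w = v \<bullet> w"
  by (simp add: inner_2 rot_nth)

lemma norm_rot: "norm (rot v) = norm v"
  by (simp add: norm_eq_sqrt_inner rot_inner_rot)

lemma bounded_linear_rot: "bounded_linear rot"
  by (intro linear_conv_bounded_linear[THEN iffD1] linearI) (auto simp: vec_eq_iff forall_2 rot_nth)

lemma rot_decomposition:
  assumes "norm n = 1"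
  shows "v = (v \<bullet> n) *\<^sub>R n + (v \<bullet> rot n) *\<^sub>R rot n"
proof -
  have n: "n $ 1 * n $ 1 + n $ 2 * n $ 2 = 1"
    using assms by (simp add: norm_eq_1 inner_2)
  have "(v$1 * n$1 + v$2 * n$2) * n$1 + (v$1 * (- n$2) + v$2 * n$1) * (- n$2) = v$1 * (n$1 * n$1 + n$2 * n$2)"
    "(v$1 * n$1 + v$2 * n$2) * n$2 + (v$1 * (- n$2) + v$2 * n$1) * n$1 = v$2 * (n$1 * n$1 + n$2 * n$2)"
    by (simp_all add: algebra_simps)
  then show ?thesis by (simp add: vec_eq_iff forall_2 inner_2 rot_nth n)
qed

section \<open>Tangent lines described by the unit normal\<close>

locale normal_curve =
  fixes M :: "(real^2) set" and n :: "real^2 \<Rightarrow> real^2"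
  assumes submanifold: "C2_submanifold M" and normal: "unit_normal_field M n"
begin

lemma norm_n: "x \<in> M \<Longrightarrow> norm (n x) = 1" and n_cont: "continuous_on M n"
  and n_orth: "x \<in> M \<Longrightarrow> v \<in> tangent_space M x \<Longrightarrow> n x \<bullet> v = 0"
  using normal by (auto simp: unit_normal_field_def)

lemma chart_at:
  assumes "p \<in> M"
  obtains U V \<phi> \<psi> \<phi>' \<psi>' where "p \<in> U" "chart M U V \<phi> \<psi> \<phi>' \<psi>'"
  using assms submanifold submanifold_chartE unfolding C2_submanifold_def by metis

lemma orth_n: "x \<in> M \<Longrightarrow> v \<bullet> n x = 0 \<Longrightarrow> v = (v \<bullet> rot (n x)) *\<^sub>R rot (n x)"
  using rot_decomposition[OF norm_n, of x v] by simp

text \<open>\<open>tangent_space\<close> asks for some chart only, so independence of the chart has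
  to be shown. The normal does it: it is orthogonal to the tangent vectors from all charts, and in
  the plane only one line is orthogonal to it. The vector \<open>w\<close> of the given chart is
  nonzero and lies on this line, so it spans it.\<close>

lemma chart_tangent_iff:
  assumes "chart M U V \<phi> \<psi> \<phi>' \<psi>'" "x \<in> U" "x \<in> M"
  shows "\<phi>' x v $ 2 = 0 \<longleftrightarrow> v \<bullet> n x = 0"
proof
  interpret chart M U V \<phi> \<psi> \<phi>' \<psi>' by fact
  show "v \<bullet> n x = 0" if "\<phi>' x v $ 2 = 0"
    using n_orth[OF assms(3) tangent_spaceI[OF assms(2) that]] by (simp add: inner_commute)
  assume v: "v \<bullet> n x = 0"
  define w where "w = \<psi>' (\<phi> x) (axis 1 1)"
  have \<phi>w: "\<phi>' x w = axis 1 1"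
    using \<phi>'_\<psi>'[OF \<phi>_in, of x] assms(2) by (simp add: w_def \<psi>_\<phi>)
  have "w \<in> tangent_space M x"
    by (rule tangent_spaceI[OF assms(2)]) (simp add: \<phi>w axis_def)
  then have "w \<bullet> n x = 0" using n_orth[OF assms(3)] by (simp add: inner_commute)
  then obtain c where w: "w = c *\<^sub>R rot (n x)" using orth_n assms by blast
  have "c \<noteq> 0" using \<phi>w w by (auto simp: axis_eq_0_iff blinfun.zero_right)
  have "v = (v \<bullet> rot (n x)) *\<^sub>R rot (n x)" using orth_n v assms by blast
  also have "\<dots> = ((v \<bullet> rot (n x)) / c) *\<^sub>R w"
    using \<open>c \<noteq> 0\<close> w by simp
  finally have "\<phi>' x v = ((v \<bullet> rot (n x)) / c) *\<^sub>R axis 1 1"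
    using \<phi>w by (metis blinfun.scaleR_right)
  then show "\<phi>' x v $ 2 = 0" by (simp add: axis_def)
qed

lemma tangent_space_iff:
  assumes "x \<in> M"
  shows "v \<in> tangent_space M x \<longleftrightarrow> v \<bullet> n x = 0"
proof
  show "v \<bullet> n x = 0" if "v \<in> tangent_space M x" using n_orth[OF assms that] by (simp add: inner_commute)
  obtain U V \<phi> \<psi> \<phi>' \<psi>' where c: "x \<in> U" "chart M U V \<phi> \<psi> \<phi>' \<psi>'" using chart_at[OF assms] .
  show "v \<in> tangent_space M x" if "v \<bullet> n x = 0"
    using chart.tangent_spaceI[OF c(2,1)] chart_tangent_iff[OF c(2,1) assms] that by blast
qed

lemma chart_normal:
  assumes "chart M U V \<phi> \<psi> \<phi>' \<psi>'" "x \<in> U" "x \<in> M"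
  shows "\<phi>' x h $ 2 = (h \<bullet> n x) * (\<phi>' x (n x) $ 2)" "\<phi>' x (n x) $ 2 \<noteq> 0"
proof -
  have "\<phi>' x (rot (n x)) $ 2 = 0" using chart_tangent_iff[OF assms] rot_orth by blast
  then show "\<phi>' x h $ 2 = (h \<bullet> n x) * (\<phi>' x (n x) $ 2)"
    by (subst rot_decomposition[OF norm_n[OF assms(3)], of h]) (simp add: blinfun.add_right blinfun.scaleR_right)
  have "n x \<bullet> n x \<noteq> 0" using norm_n[OF assms(3)] by force
  then show "\<phi>' x (n x) $ 2 \<noteq> 0" using chart_tangent_iff[OF assms] by blast
qed

subsection \<open>Tangential gradients\<close>

text \<open>The gradient on \<open>M\<close> must be tangent, but \<open>F\<close> may have a normal
  derivative. Subtracting \<open>a\<close> times the second chart coordinate cancels it and changes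
  no value on \<open>M\<close>, where this coordinate is 0.\<close>

lemma has_tangential_gradient_restrict:
  assumes p: "p \<in> M" and F: "(F has_derivative F') (at p)" and W: "open W" "p \<in> W"
    and eq: "\<And>x. x \<in> M \<Longrightarrow> x \<in> W \<Longrightarrow> f x = F x"
  shows "has_tangential_gradient M f p (F' (rot (n p)) *\<^sub>R rot (n p))"
proof -
  obtain U V \<phi> \<psi> \<phi>' \<psi>' where c: "p \<in> U" "chart M U V \<phi> \<psi> \<phi>' \<psi>'" using chart_at[OF p] .
  interpret chart M U V \<phi> \<psi> \<phi>' \<psi>' by (rule c)
  define a where "a = F' (n p) / (\<phi>' p (n p) $ 2)"
  interpret F': bounded_linear F' using F by (rule has_derivative_bounded_linear)
  have d: "((\<lambda>x. F x - a * (\<phi> x $ 2)) has_derivative (\<lambda>h. F' h - a * (\<phi>' p h $ 2))) (at p)"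
    by (intro has_derivative_diff F has_derivative_mult_right bounded_linear.has_derivative[OF bounded_linear_vec_nth] \<phi>_deriv c)
  have eq': "(\<lambda>h. F' h - a * (\<phi>' p h $ 2)) = (\<bullet>) (F' (rot (n p)) *\<^sub>R rot (n p))"
  proof
    fix h
    have "F' h = (h \<bullet> n p) * F' (n p) + (h \<bullet> rot (n p)) * F' (rot (n p))"
      by (subst rot_decomposition[OF norm_n[OF p], of h]) (simp add: F'.add F'.scaleR)
    moreover have "a * (\<phi>' p h $ 2) = (h \<bullet> n p) * F' (n p)"
      unfolding a_def chart_normal(1)[OF c(2,1) p, of h] using chart_normal(2)[OF c(2,1) p] by simp
    ultimately show "F' h - a * (\<phi>' p h $ 2) = (F' (rot (n p)) *\<^sub>R rot (n p)) \<bullet> h" by (simp add: inner_commute)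
  qed
  have "((\<lambda>x. F x - a * (\<phi> x $ 2)) has_derivative (\<bullet>) (F' (rot (n p)) *\<^sub>R rot (n p))) (at p within M \<inter> (W \<inter> U))"
    using has_derivative_at_withinI[OF d] unfolding eq' .
  then have "(f has_derivative (\<bullet>) (F' (rot (n p)) *\<^sub>R rot (n p))) (at p within M \<inter> (W \<inter> U))"
    by (rule has_derivative_transform[rotated 2]) (use p W c eq M_iff in auto)
  moreover have "at p within M \<inter> (W \<inter> U) = at p within M"
    by (rule at_within_nhd[of _ "W \<inter> U"]) (use W c open_U in auto)
  ultimately show ?thesis
    unfolding has_tangential_gradient_def by (simp add: tangent_space_iff[OF p] rot_orth)
qed

end

text \<open>In a chart, \<open>s \<mapsto> \<psi> (hpt s)\<close> parametrizes \<open>M\<close> for \<open>s \<ge> 0\<close>; for \<open>s < 0\<close> it continues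
  \<open>M\<close> beyond its tip.\<close>

definition hpt :: "real \<Rightarrow> real^2" where "hpt s = s *\<^sub>R axis 1 1"

lemma hpt_nth [simp]: "hpt s $ 1 = s" "hpt s $ 2 = 0"
  by (simp_all add: hpt_def axis_def)

lemma hpt_eqI: "y $ 2 = 0 \<Longrightarrow> hpt (y $ 1) = y"
  by (simp add: vec_eq_iff forall_2)

lemma dist_hpt [simp]: "dist (hpt s) (hpt t) = \<bar>s - t\<bar>"
  by (simp add: hpt_def dist_norm scaleR_diff_left[symmetric])

context chart
begin

lemma curve_in_M: "hpt s \<in> V \<Longrightarrow> s \<ge> 0 \<Longrightarrow> \<psi> (hpt s) \<in> M"
  using M_iff[OF \<psi>_in] \<phi>_\<psi> by simp

lemma curve_deriv:
  assumes "hpt s \<in> V"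
  shows "((\<lambda>s. \<psi> (hpt s)) has_vector_derivative \<psi>' (hpt s) (axis 1 1)) (at s within S)"
proof -
  have "(hpt has_derivative (\<lambda>h. h *\<^sub>R axis 1 1)) (at s within S)"
    unfolding hpt_def by (auto intro!: derivative_eq_intros)
  from has_derivative_compose[OF this \<psi>_deriv[OF assms]]
  show ?thesis by (simp add: has_vector_derivative_def blinfun.scaleR_right)
qed

text \<open>\<open>S\<close> lies in the nonnegative half-line, where the curve runs in
  \<open>M\<close>; so a derivative within \<open>M\<close> suffices, and at a tip the result is a
  one-sided derivative.\<close>

lemma function_along_curve_deriv:
  assumes f: "has_tangential_gradient M f (\<psi> (hpt s)) v" and s: "s \<in> S"
    and S: "\<And>r. r \<in> S \<Longrightarrow> r \<ge> 0 \<and> hpt r \<in> V"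
  shows "((\<lambda>s. f (\<psi> (hpt s))) has_real_derivative v \<bullet> \<psi>' (hpt s) (axis 1 1)) (at s within S)"
proof -
  let ?\<gamma> = "\<lambda>s. \<psi> (hpt s)"
  have "?\<gamma> ` S \<subseteq> M" using S curve_in_M by blast
  then have "(f has_derivative (\<bullet>) v) (at (?\<gamma> s) within ?\<gamma> ` S)"
    using f has_derivative_subset unfolding has_tangential_gradient_def by blast
  from has_derivative_in_compose[OF curve_deriv[unfolded has_vector_derivative_def] this, OF conjunct2[OF S[OF s]]]
  show ?thesis unfolding has_field_derivative_def by (rule has_derivative_eq_rhs) (simp add: fun_eq_iff)
qed

end

text \<open>Both candidates yield the derivative of \<open>f\<close> along the chart curve, hence
  have the same inner product with its velocity \<open>t\<close>. As \<open>t\<close> spans the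
  tangent line that contains both, they coincide. This gives meaning to the \<open>THE\<close> in
  \<open>tangential_gradient\<close>.\<close>

lemma (in normal_curve) has_tangential_gradient_unique:
  assumes p: "p \<in> M" and v: "has_tangential_gradient M f p v" and w: "has_tangential_gradient M f p w"
  shows "v = w"
proof -
  obtain U V \<phi> \<psi> \<phi>' \<psi>' where c: "p \<in> U" "chart M U V \<phi> \<psi> \<phi>' \<psi>'" using chart_at[OF p] .
  interpret chart M U V \<phi> \<psi> \<phi>' \<psi>' by (rule c)
  have q: "\<phi> p $ 1 \<ge> 0" "\<phi> p $ 2 = 0" using M_iff[OF c(1)] p by auto
  define s where "s = \<phi> p $ 1"
  have hs: "hpt s = \<phi> p" using hpt_eqI q by (simp add: s_def)
  obtain e where e: "e > 0" "ball (\<phi> p) e \<subseteq> V" using openE[OF open_V \<phi>_in[OF c(1)]] by blast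
  \<comment> \<open>Only parameters to the right of \<open>s\<close> are used: if \<open>p\<close>
    is a tip then \<open>s = 0\<close>, and the curve is in \<open>M\<close> on that side
    only.\<close>
  define S where "S = {s..s+e/2}"
  have S: "r \<ge> 0 \<and> hpt r \<in> V" if "r \<in> S" for r
  proof
    show "r \<ge> 0" using that q by (auto simp: S_def s_def)
    have "dist (\<phi> p) (hpt r) < e" using that e unfolding hs[symmetric] by (auto simp: S_def)
    then show "hpt r \<in> V" using e by auto
  qed
  have sS: "s \<in> S" using e by (simp add: S_def)
  have \<psi>s: "\<psi> (hpt s) = p" using hs \<psi>_\<phi> c by simp
  define t where "t = \<psi>' (hpt s) (axis 1 1)"
  have "((\<lambda>s. f (\<psi> (hpt s))) has_real_derivative v \<bullet> t) (at s within S)"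
    "((\<lambda>s. f (\<psi> (hpt s))) has_real_derivative w \<bullet> t) (at s within S)"
    unfolding t_def by (rule function_along_curve_deriv; use v w \<psi>s sS S in simp)+
  moreover have "at s within S \<noteq> bot"
    using e unfolding S_def by (simp add: at_within_Icc_at_right)
  ultimately have vw: "v \<bullet> t = w \<bullet> t"
    by (rule has_field_derivative_unique)
  have \<phi>t: "\<phi>' p t = axis 1 1"
    using \<phi>'_\<psi>'[of "hpt s" "axis 1 1"] S[OF sS] by (simp add: t_def \<psi>s)
  then have "t \<noteq> 0" by (auto simp: axis_eq_0_iff blinfun.zero_right)
  have "t \<bullet> n p = 0" using chart_tangent_iff[OF c(2,1) p, of t] \<phi>t by (simp add: axis_def)
  then obtain k where t: "t = k *\<^sub>R rot (n p)" using orth_n p by blast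
  then have "k \<noteq> 0" using \<open>t \<noteq> 0\<close> by auto
  have "(v - w) \<bullet> n p = 0"
    using v w tangent_space_iff[OF p] by (simp add: has_tangential_gradient_def inner_diff_left)
  then have d: "v - w = ((v - w) \<bullet> rot (n p)) *\<^sub>R rot (n p)" using orth_n p by blast
  have "0 = (v - w) \<bullet> t" using vw by (simp add: inner_diff_left)
  also have "\<dots> = k * ((v - w) \<bullet> rot (n p))" by (simp add: t)
  finally have "(v - w) \<bullet> rot (n p) = 0" using \<open>k \<noteq> 0\<close> by simp
  with d show "v = w" by (metis eq_iff_diff_eq_0 scale_zero_left)
qed

section \<open>C1 functions on the curve and regularity of the normal\<close>

context normal_curve
begin

lemma tangential_gradient_eq: "p \<in> M \<Longrightarrow> has_tangential_gradient M f p v \<Longrightarrow> tangential_gradient M f p = v"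
  unfolding tangential_gradient_def using has_tangential_gradient_unique by blast

lemma C1_mfd_iff:
  "f \<in> C1_mfd M \<longleftrightarrow> (\<forall>x. x \<notin> M \<longrightarrow> f x = 0) \<and> continuous_on M (tangential_gradient M f) \<and>
     (\<forall>p\<in>M. has_tangential_gradient M f p (tangential_gradient M f p))"
proof -
  have "continuous_on M (tangential_gradient M f) \<and> (\<forall>p\<in>M. has_tangential_gradient M f p (tangential_gradient M f p))"
    if "continuous_on M G" "\<forall>p\<in>M. has_tangential_gradient M f p (G p)" for G
  proof -
    have "tangential_gradient M f p = G p" if "p \<in> M" for p
      using tangential_gradient_eq \<open>\<forall>p\<in>M. has_tangential_gradient M f p (G p)\<close> that by blast
    then show ?thesis using that by (metis (no_types, lifting) continuous_on_cong)
  qed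
  then show ?thesis unfolding C1_mfd_def by blast
qed

lemma C1_mfdI:
  assumes zero: "\<And>x. x \<notin> M \<Longrightarrow> f x = 0"
    and loc: "\<And>p. p \<in> M \<Longrightarrow> \<exists>W F. open W \<and> p \<in> W \<and> C1_on W F \<and> (\<forall>x\<in>M \<inter> W. f x = F x)"
  shows "f \<in> C1_mfd M"
proof -
  have *: "has_tangential_gradient M f p (tangential_gradient M f p) \<and>
       continuous (at p within M) (tangential_gradient M f)" if p: "p \<in> M" for p
  proof -
    obtain W F where W: "open W" "p \<in> W" "C1_on W F" "\<And>x. x \<in> M \<Longrightarrow> x \<in> W \<Longrightarrow> f x = F x"
      using loc[OF p] by blast
    obtain F' where F': "\<And>x. x \<in> W \<Longrightarrow> (F has_derivative blinfun_apply (F' x)) (at x)" "continuous_on W F'"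
      using C1_onE[OF W(3)] by blast
    define G where "G = (\<lambda>x. F' x (rot (n x)) *\<^sub>R rot (n x))"
    have G: "has_tangential_gradient M f x (G x)" if "x \<in> M \<inter> W" for x
      unfolding G_def using that
      by (intro has_tangential_gradient_restrict[OF _ F'(1) W(1) _ W(4)]) auto
    have eq: "tangential_gradient M f x = G x" if "x \<in> M \<inter> W" for x
      using tangential_gradient_eq[OF _ G[OF that]] that by blast
    have "continuous_on (M \<inter> W) (\<lambda>x. rot (n x))"
      by (rule continuous_on_subset[OF bounded_linear.continuous_on[OF bounded_linear_rot n_cont]]) auto
    then have "continuous_on (M \<inter> W) G"
      unfolding G_def by (intro continuous_intros continuous_on_subset[OF F'(2)]) auto
    then have "continuous_on (M \<inter> W) (tangential_gradient M f)"
      by (rule continuous_on_eq) (simp add: eq)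
    then have "continuous (at p within M \<inter> W) (tangential_gradient M f)"
      using p W(2) by (simp add: continuous_on_eq_continuous_within)
    moreover have "at p within M \<inter> W = at p within M"
      by (rule at_within_nhd[of _ W]) (use W in auto)
    ultimately show ?thesis using G[of p] eq[of p] p W(2) by simp
  qed
  then show ?thesis unfolding C1_mfd_iff continuous_on_eq_continuous_within using zero by blast
qed

lemma C1_mfd_restrict:
  assumes "C1_on UNIV F"
  shows "(\<lambda>x. if x \<in> M then F x else 0) \<in> C1_mfd M"
  by (rule C1_mfdI) (use assms in \<open>auto intro!: exI[of _ UNIV] exI[of _ F]\<close>)

text \<open>The field \<open>n\<close> is given as continuous only; its regularity comes from the
  curve. The gradient \<open>m\<close> of the second chart coordinate is C1 because
  \<open>\<phi>\<close> is C2, it has no zero, and on \<open>M\<close> it is normal. Its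
  normalisation \<open>N\<close> is therefore \<open>n\<close> up to sign.\<close>

lemma normal_locally_C1:
  assumes p: "p \<in> M"
  obtains W N where "open W" "p \<in> W" "C1_on W N" "\<And>x. x \<in> M \<inter> W \<Longrightarrow> n x = N x"
proof -
  obtain U V \<phi> \<psi> \<phi>' \<psi>' where c: "p \<in> U" "chart M U V \<phi> \<psi> \<phi>' \<psi>'" using chart_at[OF p] .
  interpret chart M U V \<phi> \<psi> \<phi>' \<psi>' by (rule c)
  define m :: "real^2 \<Rightarrow> real^2" where "m = (\<lambda>x. (\<phi>' x (axis 1 1) $ 2) *\<^sub>R axis 1 1 + (\<phi>' x (axis 2 1) $ 2) *\<^sub>R axis 2 1)"
  have comp: "C1_on U (\<lambda>x. \<phi>' x a $ 2)" for a
    by (intro C1_on_vec_nth C1_on_bilinear[OF bounded_bilinear_blinfun_apply] \<phi>'_C1 C1_on_const)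
  have m_C1: "C1_on U m"
    unfolding m_def by (intro C1_on_add C1_on_scaleR C1_on_const comp)
  have m: "\<phi>' x h $ 2 = m x \<bullet> h" for x h
  proof -
    have "h = (h $ 1) *\<^sub>R axis 1 1 + (h $ 2) *\<^sub>R axis 2 1"
      by (simp add: vec_eq_iff forall_2 axis_def)
    then have "\<phi>' x h = (h $ 1) *\<^sub>R \<phi>' x (axis 1 1) + (h $ 2) *\<^sub>R \<phi>' x (axis 2 1)"
      by (metis blinfun.add_right blinfun.scaleR_right)
    then show ?thesis by (simp add: m_def inner_2 axis_def mult.commute)
  qed
  have m0: "m x \<noteq> 0" if "x \<in> U" for x
  proof
    assume "m x = 0"
    then have "\<phi>' x (\<psi>' (\<phi> x) (axis 2 1)) $ 2 = 0" by (simp add: m)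
    moreover have "\<phi>' x (\<psi>' (\<phi> x) (axis 2 1)) = axis 2 1"
      using \<phi>'_\<psi>'[OF \<phi>_in[OF that]] \<psi>_\<phi>[OF that] by simp
    ultimately show False by (simp add: axis_def)
  qed
  have mn: "m x = (m x \<bullet> n x) *\<^sub>R n x" if "x \<in> U" "x \<in> M" for x
  proof -
    have "m x \<bullet> rot (n x) = 0"
      using chart_tangent_iff[OF c(2) that, of "rot (n x)"] by (simp add: m rot_orth)
    then show ?thesis using rot_decomposition[OF norm_n[OF that(2)], of "m x"] by simp
  qed
  define N where "N = (\<lambda>x. inverse (sqrt (m x \<bullet> m x)) *\<^sub>R m x)"
  have N_C1: "C1_on U N"
    unfolding N_def
    by (intro C1_on_scaleR C1_on_compose[OF C1_on_inverse_sqrt] C1_on_inner m_C1) (use m0 in auto)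
  have N: "N x = sgn (m x \<bullet> n x) *\<^sub>R n x" if x: "x \<in> U" "x \<in> M" for x
  proof -
    define a where "a = m x \<bullet> n x"
    have ma: "m x = a *\<^sub>R n x" using mn[OF x] by (simp add: a_def)
    have "N x = inverse (norm (m x)) *\<^sub>R m x" by (simp add: N_def norm_eq_sqrt_inner)
    also have "\<dots> = (inverse \<bar>a\<bar> * a) *\<^sub>R n x" by (simp add: ma norm_n[OF x(2)])
    also have "inverse \<bar>a\<bar> * a = sgn a" by (simp add: sgn_real_def field_simps)
    finally show ?thesis by (simp add: a_def)
  qed
  have ne: "m x \<bullet> n x \<noteq> 0" if "x \<in> U" "x \<in> M" for x
    using mn[OF that] m0[OF that(1)] by force
  \<comment> \<open>On \<open>M\<close>, \<open>N = \<plusminus> n\<close>, and by continuity of \<open>n\<close> the sign is constant near \<open>p\<close>.\<close>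
  define \<sigma> where "\<sigma> = sgn (m p \<bullet> n p)"
  have \<sigma>: "\<sigma> * \<sigma> = 1" using ne[OF c(1) p] by (simp add: \<sigma>_def sgn_mult_self_eq)
  have "continuous_on (M \<inter> U) (\<lambda>x. \<sigma> * (m x \<bullet> n x))"
    by (intro continuous_intros continuous_on_subset[OF n_cont] continuous_on_subset[OF C1_on_continuous_on[OF m_C1]]) auto
  moreover have "open {0::real<..}" by simp
  ultimately obtain T where T: "open T" "T \<inter> (M \<inter> U) = (\<lambda>x. \<sigma> * (m x \<bullet> n x)) -` {0<..} \<inter> (M \<inter> U)"
    unfolding continuous_on_open_invariant by blast
  have "\<sigma> * (m p \<bullet> n p) > 0" using ne[OF c(1) p] by (simp add: \<sigma>_def sgn_real_def)
  then have pT: "p \<in> T" using T(2) p c(1) by blast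
  show ?thesis
  proof
    show "open (T \<inter> U)" "p \<in> T \<inter> U" using T pT c open_U by auto
    show "C1_on (T \<inter> U) (\<lambda>x. \<sigma> *\<^sub>R N x)"
      by (intro C1_on_scaleR C1_on_const C1_on_subset[OF N_C1]) auto
    fix x assume x: "x \<in> M \<inter> (T \<inter> U)"
    then have "x \<in> (\<lambda>x. \<sigma> * (m x \<bullet> n x)) -` {0<..} \<inter> (M \<inter> U)" using T(2) by blast
    then have pos: "\<sigma> * (m x \<bullet> n x) > 0" by simp
    have "\<sigma> * sgn (m x \<bullet> n x) = sgn (\<sigma> * (m x \<bullet> n x))"
      by (simp add: sgn_mult \<sigma>_def)
    then have "\<sigma> * sgn (m x \<bullet> n x) = 1" using pos by simp
    then show "n x = \<sigma> *\<^sub>R N x" using N x by simp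
  qed
qed

lemma normal_component_C1_mfd: "(\<lambda>x. if x \<in> M then n x $ i else 0) \<in> C1_mfd M"
proof (rule C1_mfdI)
  fix p assume "p \<in> M"
  then obtain W N where W: "open W" "p \<in> W" "C1_on W N" "\<And>x. x \<in> M \<inter> W \<Longrightarrow> n x = N x"
    using normal_locally_C1 by blast
  then show "\<exists>W F. open W \<and> p \<in> W \<and> C1_on W F \<and> (\<forall>x\<in>M \<inter> W. (if x \<in> M then n x $ i else 0) = F x)"
    using C1_on_vec_nth[OF W(3), of i] by (intro exI[of _ W] exI[of _ "\<lambda>x. N x $ i"]) auto
qed simp

lemma C1_mfd_add:
  assumes "f \<in> C1_mfd M" "g \<in> C1_mfd M"
  shows "(\<lambda>x. f x + g x) \<in> C1_mfd M"
proof -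
  obtain G H where "continuous_on M G" "\<forall>p\<in>M. has_tangential_gradient M f p (G p)"
    "continuous_on M H" "\<forall>p\<in>M. has_tangential_gradient M g p (H p)"
    using assms unfolding C1_mfd_def by blast
  then have "continuous_on M (\<lambda>x. G x + H x)" "\<forall>p\<in>M. has_tangential_gradient M (\<lambda>x. f x + g x) p (G p + H p)"
    unfolding has_tangential_gradient_def
    by (auto intro!: continuous_intros derivative_eq_intros simp: tangent_space_iff inner_add_left inner_add_right)
  then show ?thesis using assms unfolding C1_mfd_def by auto
qed

lemma C1_mfd_scaleR:
  assumes "f \<in> C1_mfd M"
  shows "(\<lambda>x. c * f x) \<in> C1_mfd M"
proof -
  obtain G where "continuous_on M G" "\<forall>p\<in>M. has_tangential_gradient M f p (G p)"
    using assms unfolding C1_mfd_def by blast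
  then have "continuous_on M (\<lambda>x. c *\<^sub>R G x)" "\<forall>p\<in>M. has_tangential_gradient M (\<lambda>x. c * f x) p (c *\<^sub>R G p)"
    unfolding has_tangential_gradient_def
    by (auto intro!: continuous_intros derivative_eq_intros simp: tangent_space_iff)
  then show ?thesis using assms unfolding C1_mfd_def by auto
qed

end

section \<open>Flows of tangential fields\<close>

text \<open>In a chart, the second coordinate \<open>y\<close> of a trajectory satisfies \<open>\<bar>y'\<bar> \<le> C \<bar>y\<bar>\<close>, because
  the second component of the transported field is Lipschitz and vanishes on \<open>M\<close>.\<close>

lemma (in normal_curve) trajectory_stays_locally:
  assumes lf: "C1_on UNIV X"
    and tang: "\<And>x. x \<in> M \<Longrightarrow> X x \<bullet> n x = 0"
    and p: "z t0 \<in> M" "z t0 \<notin> mfd_boundary M"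
    and z: "\<And>t. (z has_vector_derivative X (z t)) (at t)"
  obtains e where "e > 0" "\<And>t. \<bar>t - t0\<bar> < e \<Longrightarrow> z t \<in> M"
proof -
  obtain U V \<phi> \<psi> \<phi>' \<psi>' where c: "z t0 \<in> U" "chart M U V \<phi> \<psi> \<phi>' \<psi>'" using chart_at[OF p(1)] .
  interpret chart M U V \<phi> \<psi> \<phi>' \<psi>' by (rule c)
  define q where "q = \<phi> (z t0)"
  have q: "q $ 1 \<ge> 0" "q $ 2 = 0" "q \<in> V" using M_iff[OF c(1)] p \<phi>_in[OF c(1)] by (auto simp: q_def)
  have "q \<noteq> 0"
    using p c(1) chart by (auto simp: mfd_boundary_def q_def)
  then have q1: "q $ 1 > 0" using q by (simp add: vec_eq_iff forall_2 less_le)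
  obtain d0 where d0: "d0 > 0" "cball q d0 \<subseteq> V" using open_V q(3) open_contains_cball by blast
  \<comment> \<open>Away from the tips the first chart coordinate is positive. Within this radius it
    stays positive, so the foot point \<open>hpt (y $ 1)\<close> corresponds to a point of
    \<open>M\<close>.\<close>
  define d where "d = min d0 (q $ 1 / 2)"
  have d: "d > 0" "cball q d \<subseteq> V" "d < q $ 1" using d0 q1 by (auto simp: d_def min_def)
  define Y where "Y = (\<lambda>y. \<phi>' (\<psi> y) (X (\<psi> y)) $ 2)"
  have X\<psi>: "C1_on V (\<lambda>y. X (\<psi> y))" and \<phi>'\<psi>: "C1_on V (\<lambda>y. \<phi>' (\<psi> y))"
    by (rule C1_on_compose[OF lf \<psi>_C1], simp) (rule C1_on_compose[OF \<phi>'_C1 \<psi>_C1], use \<psi>_in in blast)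
  have "C1_on V Y" unfolding Y_def
    by (intro C1_on_vec_nth C1_on_bilinear[OF bounded_bilinear_blinfun_apply] X\<psi> \<phi>'\<psi>)
  then obtain C where C: "C > 0" "\<And>x y. x \<in> cball q d \<Longrightarrow> y \<in> cball q d \<Longrightarrow> norm (Y x - Y y) \<le> C * norm (x - y)"
    using C1_on_lipschitz[OF _ compact_cball convex_cball d(2)] by blast
  have Y: "\<bar>Y y\<bar> \<le> C * \<bar>y $ 2\<bar>" if y: "y \<in> cball q d" for y
  proof -
    have "\<bar>q $ 1 - y $ 1\<bar> \<le> norm (q - y)" using component_le_norm_cart[of "q - y" 1] by simp
    then have y1: "\<bar>q $ 1 - y $ 1\<bar> \<le> d" using y by (simp add: dist_norm)
    have "dist q (hpt (y $ 1)) \<le> d"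
      using y1 dist_hpt[of "q $ 1" "y $ 1"] hpt_eqI[OF q(2)] by simp
    then have h: "hpt (y $ 1) \<in> cball q d" by simp
    then have "hpt (y $ 1) \<in> V" using d by blast
    moreover have "y $ 1 \<ge> 0" using y1 d by linarith
    ultimately have M: "\<psi> (hpt (y $ 1)) \<in> M" "\<psi> (hpt (y $ 1)) \<in> U" using curve_in_M \<psi>_in by auto
    then have "Y (hpt (y $ 1)) = 0"
      unfolding Y_def using chart_tangent_iff[OF c(2)] tang by blast
    then have "\<bar>Y y\<bar> \<le> C * norm (y - hpt (y $ 1))" using C(2)[OF y h] by simp
    also have "y - hpt (y $ 1) = axis 2 (y $ 2)" by (simp add: vec_eq_iff forall_2 axis_def)
    finally show ?thesis by (simp add: norm_eq_sqrt_inner inner_2 axis_def)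
  qed
  have cz: "isCont z t" for t using z has_vector_derivative_continuous by blast
  have op: "open (U \<inter> \<phi> -` ball q d)"
    using continuous_open_preimage[OF C1_on_continuous_on[OF \<phi>_C1] open_U open_ball] .
  have "(z \<longlongrightarrow> z t0) (nhds t0)"
    using cz[of t0] by (simp only: isCont_def tendsto_at_iff_tendsto_nhds)
  from topological_tendstoD[OF this op]
  have "\<forall>\<^sub>F t in nhds t0. z t \<in> U \<inter> \<phi> -` ball q d" using c d by (simp add: q_def)
  then obtain e where e: "e > 0" "\<And>t. dist t t0 < e \<Longrightarrow> z t \<in> U \<inter> \<phi> -` ball q d"
    unfolding eventually_nhds_metric by blast
  have "z t \<in> M" if t: "\<bar>t - t0\<bar> < e" for t
  proof -
    have in_U: "z s \<in> U" "\<phi> (z s) \<in> ball q d" if "s \<in> closed_segment t0 t" for s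
    proof -
      have "dist s t0 < e" using that t by (auto simp: closed_segment_eq_real_ivl dist_real_def split: if_splits)
      then show "z s \<in> U" "\<phi> (z s) \<in> ball q d" using e(2) by auto
    qed
    \<comment> \<open>The square is differentiable where the coordinate vanishes, unlike its
      absolute value; the Gronwall rate becomes \<open>2 * C\<close>.\<close>
    have "(\<phi> (z t) $ 2)\<^sup>2 = 0"
    proof (rule gronwall_zero[where ?t0.0 = t0 and t = t and w = "\<lambda>t. (\<phi> (z t) $ 2)\<^sup>2" and K = "2 * C"
          and w' = "\<lambda>s. 2 * (\<phi> (z s) $ 2) * (\<phi>' (z s) (X (z s)) $ 2)"])
      fix s assume s: "s \<in> closed_segment t0 t"
      have "((\<lambda>s. \<phi> (z s)) has_derivative (\<lambda>h. \<phi>' (z s) (h *\<^sub>R X (z s)))) (at s)"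
        using has_derivative_compose[OF z[unfolded has_vector_derivative_def] \<phi>_deriv[OF in_U(1)[OF s]]] .
      then have "((\<lambda>s. \<phi> (z s) $ 2) has_derivative (\<lambda>h. \<phi>' (z s) (h *\<^sub>R X (z s)) $ 2)) (at s)"
        by (rule bounded_linear.has_derivative[OF bounded_linear_vec_nth])
      then have "((\<lambda>s. \<phi> (z s) $ 2) has_real_derivative (\<phi>' (z s) (X (z s)) $ 2)) (at s)"
        unfolding has_field_derivative_def by (rule has_derivative_eq_rhs) (simp add: fun_eq_iff blinfun.scaleR_right)
      then show "((\<lambda>t. (\<phi> (z t) $ 2)\<^sup>2) has_real_derivative 2 * (\<phi> (z s) $ 2) * (\<phi>' (z s) (X (z s)) $ 2)) (at s)"
        by (auto intro!: derivative_eq_intros)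
      have "\<bar>\<phi>' (z s) (X (z s)) $ 2\<bar> \<le> C * \<bar>\<phi> (z s) $ 2\<bar>"
        using Y[of "\<phi> (z s)"] in_U[OF s] by (simp add: Y_def \<psi>_\<phi>)
      then have "\<bar>\<phi> (z s) $ 2\<bar> * \<bar>\<phi>' (z s) (X (z s)) $ 2\<bar> \<le> \<bar>\<phi> (z s) $ 2\<bar> * (C * \<bar>\<phi> (z s) $ 2\<bar>)"
        by (intro mult_left_mono) auto
      also have "\<dots> = C * (\<phi> (z s) $ 2)\<^sup>2" by (simp add: power2_eq_square flip: abs_mult)
      finally show "\<bar>2 * (\<phi> (z s) $ 2) * (\<phi>' (z s) (X (z s)) $ 2)\<bar> \<le> 2 * C * (\<phi> (z s) $ 2)\<^sup>2"
        by (simp add: abs_mult)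
    qed (use q in \<open>auto simp: q_def\<close>)
    then have y2: "\<phi> (z t) $ 2 = 0" by simp
    have t: "t \<in> closed_segment t0 t" by simp
    have "\<bar>q $ 1 - \<phi> (z t) $ 1\<bar> \<le> norm (q - \<phi> (z t))" using component_le_norm_cart[of "q - \<phi> (z t)" 1] by simp
    also have "\<dots> < d" using in_U(2)[OF t] by (simp add: dist_norm)
    finally have "\<phi> (z t) $ 1 \<ge> 0" using d by linarith
    then show ?thesis using M_iff[OF in_U(1)[OF t]] y2 by blast
  qed
  then show ?thesis using e(1) that by blast
qed

text \<open>The times spent in \<open>M\<close> form a closed and open set, hence the whole line.
  Openness has two sources: the local invariance at interior points, and at a tip the zero of
  \<open>X\<close>, where the trajectory is constant.\<close>

lemma (in normal_curve) flow_preserves_M: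
  assumes "closed M" and X: "X \<in> C1c D" and tang: "\<And>x. x \<in> M \<Longrightarrow> X x \<bullet> n x = 0"
    and bdry: "\<And>x. x \<in> mfd_boundary M \<Longrightarrow> X x = 0" and x: "x \<in> M"
  shows "flow X t x \<in> M"
proof -
  obtain K B where "lipschitz_field X K B" using C1c_lipschitz_field[OF X] .
  then interpret lipschitz_field X K B .
  let ?T = "{t. flow X t x \<in> M}"
  have "isCont (\<lambda>t. flow X t x) t" for t
    using flow_deriv by (rule has_vector_derivative_continuous)
  then have "closed ?T"
    using continuous_closed_vimage[OF assms(1), of "\<lambda>t. flow X t x"] by (simp add: vimage_def)
  moreover have "open ?T"
    unfolding open_dist
  proof
    fix t0 assume t0: "t0 \<in> ?T"
    show "\<exists>e>0. \<forall>t. dist t t0 < e \<longrightarrow> t \<in> ?T"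
    proof (cases "flow X t0 x \<in> mfd_boundary M")
      case True
      then have "X (flow X t0 x) = 0" by (rule bdry)
      then have "flow X t x \<in> M" for t using flow_zero[of t0 x t] t0 by simp
      then show ?thesis using zero_less_one by blast
    next
      case False
      have C1: "C1_on UNIV X" using X by (simp add: C1c_def)
      obtain e where "e > 0" "\<And>t. \<bar>t - t0\<bar> < e \<Longrightarrow> flow X t x \<in> M"
        using trajectory_stays_locally[OF C1 tang, of "\<lambda>t. flow X t x" t0] t0 False flow_deriv by blast
      then show ?thesis by (auto simp: dist_real_def)
    qed
  qed
  moreover have "0 \<in> ?T" using x by (simp add: flow_0)
  ultimately have "?T = UNIV" using clopen[THEN iffD1, OF conjI, of ?T] by blast
  then show ?thesis by blast
qed

text \<open>A trajectory cannot leave \<open>D\<close>, because all points outside are at rest. It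
  cannot reach \<open>M\<close> either, since the reversed flow would have kept it in
  \<open>M\<close> from the start.\<close>

lemma (in normal_curve) flow_preserves_cracked_set:
  assumes "closed M" and X: "X \<in> C1c D" and tang: "\<And>x. x \<in> M \<Longrightarrow> X x \<bullet> n x = 0"
    and bdry: "\<And>x. x \<in> mfd_boundary M \<Longrightarrow> X x = 0"
  shows "flow X t ` (D - M) = D - M"
proof -
  obtain K B where "lipschitz_field X K B" using C1c_lipschitz_field[OF X] .
  then interpret lipschitz_field X K B .
  have out: "X x = 0" if "x \<notin> D" for x
    using X that closure_subset[of "{x. X x \<noteq> 0}"] by (auto simp: C1c_def)
  have "flow X t x \<in> D - M" if x: "x \<in> D - M" for t x
  proof
    show "flow X t x \<in> D"
    proof (rule ccontr)
      assume "flow X t x \<notin> D"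
      then have "flow X 0 x = flow X t x" by (intro flow_zero out)
      then show False using x \<open>flow X t x \<notin> D\<close> by (simp add: flow_0)
    qed
    show "flow X t x \<notin> M"
    proof
      assume "flow X t x \<in> M"
      then have "flow X (- t) (flow X t x) \<in> M" using flow_preserves_M[OF assms] by blast
      then show False using x by (simp add: flow_inverse)
    qed
  qed
  then show ?thesis by (rule flow_image_eq)
qed

text \<open>All difference quotients vanish. The assumed existence of a derivative supplies the
  membership in \<open>\<Xi>\<close>, and uniqueness of limits lets \<open>THE\<close> select
  0.\<close>

lemma eulerian_semiderivative_eq_0:
  assumes "\<And>t. flow X t ` \<Omega> = \<Omega>" and ex: "\<exists>l. has_eulerian_semiderivative \<Xi> J \<Omega> X l"
  shows "eulerian_semiderivative \<Xi> J \<Omega> X = 0"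
  unfolding eulerian_semiderivative_def
proof (rule the_equality)
  have lim: "((\<lambda>t. (J (flow X t ` \<Omega>) - J \<Omega>) / t) \<longlongrightarrow> 0) (at_right 0)" by (simp add: assms(1))
  show "has_eulerian_semiderivative \<Xi> J \<Omega> X 0"
    using ex lim by (auto simp: has_eulerian_semiderivative_def)
  show "l = 0" if "has_eulerian_semiderivative \<Xi> J \<Omega> X l" for l
    using that lim tendsto_unique[OF trivial_limit_at_right_real] by (auto simp: has_eulerian_semiderivative_def)
qed

section \<open>Extension of C1 functions from a curve to the plane\<close>

text \<open>Reflecting the graph in the point \<open>(0, g 0)\<close> continues the derivative
  evenly, so the one-sided derivatives at 0 match for any \<open>g' 0\<close>; an even reflection
  would in general leave a kink.\<close>

lemma odd_reflection_has_derivative: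
  fixes g g' :: "real \<Rightarrow> real"
  assumes I: "open I" "\<And>s. s \<in> I \<Longrightarrow> \<bar>s\<bar> \<in> I"
    and g: "\<And>s. s \<in> I \<inter> {0..} \<Longrightarrow> (g has_real_derivative g' s) (at s within I \<inter> {0..})"
    and s: "s \<in> I"
  defines "e \<equiv> \<lambda>s. if s \<ge> 0 then g s else 2 * g 0 - g (- s)"
  shows "(e has_real_derivative g' \<bar>s\<bar>) (at s)"
proof -
  have right: "(e has_real_derivative g' \<bar>s\<bar>) (at s within I \<inter> {0..})" if "s \<ge> 0"
  proof -
    have "(g has_real_derivative g' \<bar>s\<bar>) (at s within I \<inter> {0..})" using g[of s] s that by simp
    then show ?thesis
      by (rule has_field_derivative_transform_within[OF _ zero_less_one]) (use s that in \<open>auto simp: e_def\<close>)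
  qed
  have left: "(e has_real_derivative g' \<bar>s\<bar>) (at s within I \<inter> {..0})" if "s \<le> 0"
  proof -
    have sub: "uminus ` (I \<inter> {..0}) \<subseteq> I \<inter> {0..}" using I(2) by force
    have "- s \<in> I" using I(2)[OF s] that by simp
    then have "(g has_real_derivative g' (- s)) (at (- s) within uminus ` (I \<inter> {..0}))"
      using DERIV_subset[OF g sub] that by simp
    moreover have "(uminus has_real_derivative - 1) (at s within I \<inter> {..0})"
      by (auto intro!: derivative_eq_intros)
    ultimately have "(g \<circ> uminus has_real_derivative g' (- s) * - 1) (at s within I \<inter> {..0})"
      by (rule DERIV_image_chain)
    from DERIV_diff[OF DERIV_const this]
    have "((\<lambda>s. 2 * g 0 - (g \<circ> uminus) s) has_real_derivative g' \<bar>s\<bar>) (at s within I \<inter> {..0})"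
      using that by simp
    then show ?thesis
      by (rule has_field_derivative_transform_within[OF _ zero_less_one]) (use s that in \<open>auto simp: e_def\<close>)
  qed
  show ?thesis
  proof (cases s "0::real" rule: linorder_cases)
    case less
    have "at s within I \<inter> {..0} = at s within UNIV"
      by (rule at_within_nhd[of s "I \<inter> {..<0}"]) (use s I(1) less in \<open>auto intro!: open_Int\<close>)
    then show ?thesis using left less by simp
  next
    case greater
    have "at s within I \<inter> {0..} = at s within UNIV"
      by (rule at_within_nhd[of s "I \<inter> {0<..}"]) (use s I(1) greater in \<open>auto intro!: open_Int\<close>)
    then show ?thesis using right greater by simp
  next
    case equal
    have "(e has_vector_derivative g' \<bar>s\<bar>) (at s within (I \<inter> {..0}) \<union> (I \<inter> {0..}))"
      by (rule has_vector_derivative_within_Un)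
        (use left right equal in \<open>simp_all add: has_real_derivative_iff_has_vector_derivative\<close>)
    moreover have "(I \<inter> {..0}) \<union> (I \<inter> {0..}) = I" by auto
    ultimately show ?thesis
      using at_within_open[OF s I(1)] by (simp add: has_real_derivative_iff_has_vector_derivative)
  qed
qed

text \<open>In a chart at a tip, \<open>f\<close> is known on a half-line only; the odd reflection continues it to a C1
  function of the first coordinate.\<close>

lemma (in normal_curve) C1_mfd_local_extension:
  assumes p: "p \<in> M"
  shows "\<exists>r>0. \<exists>C\<ge>0. \<forall>f\<in>C1_mfd M. \<forall>b. (\<forall>x\<in>M. \<bar>f x\<bar> \<le> b \<and> norm (tangential_gradient M f x) \<le> b) \<longrightarrow>
     (\<exists>F. C1_bounded_on (ball p r) F (C * b) \<and> (\<forall>x\<in>M \<inter> ball p r. F x = f x))"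
proof -
  obtain U V \<phi> \<psi> \<phi>' \<psi>' where c: "p \<in> U" "chart M U V \<phi> \<psi> \<phi>' \<psi>'" using chart_at[OF p] .
  interpret chart M U V \<phi> \<psi> \<phi>' \<psi>' by (rule c)
  define q where "q = \<phi> p"
  have q: "q $ 1 \<ge> 0" "q $ 2 = 0" "q \<in> V" using M_iff[OF c(1)] p \<phi>_in[OF c(1)] by (auto simp: q_def)
  obtain d0 where d0: "d0 > 0" "cball q d0 \<subseteq> V" using open_V q(3) open_contains_cball by blast
  \<comment> \<open>If \<open>q $ 1 = 0\<close>, then \<open>I\<close> is symmetric about 0;
    otherwise it stays in the positive half-line. In both cases \<open>I\<close> contains
    \<open>\<bar>s\<bar>\<close> with \<open>s\<close>, as the reflection demands.\<close>
  define d where "d = (if q $ 1 = 0 then d0 else min d0 (q $ 1))"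
  have d: "d > 0" "cball q d \<subseteq> V" "q $ 1 = 0 \<or> d \<le> q $ 1"
    using d0 q by (auto simp: d_def)
  define I where "I = {q $ 1 - d <..< q $ 1 + d}"
  have I: "open I" "\<And>s. s \<in> I \<Longrightarrow> \<bar>s\<bar> \<in> I" using d q by (auto simp: I_def)
  have hI: "hpt s \<in> cball q d" if "s \<in> I" for s
    using that dist_hpt[of "q $ 1" s] hpt_eqI[OF q(2)] by (auto simp: I_def)
  have hV: "hpt s \<in> V" if "s \<in> I" for s using hI[OF that] d by blast
  obtain C1 where C1: "C1 > 0" "\<And>y. y \<in> cball q d \<Longrightarrow> norm (\<psi>' y) \<le> C1"
  proof -
    have "bounded (\<psi>' ` cball q d)"
      using C1_on_continuous_on[OF \<psi>'_C1] d(2)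
      by (meson compact_cball compact_continuous_image compact_imp_bounded continuous_on_subset)
    then show ?thesis using that unfolding bounded_pos by auto
  qed
  have op: "open (U \<inter> \<phi> -` ball q d)"
    using continuous_open_preimage[OF C1_on_continuous_on[OF \<phi>_C1] open_U open_ball] .
  have "p \<in> U \<inter> \<phi> -` ball q d" using c d by (simp add: q_def)
  then obtain r where r: "r > 0" "cball p r \<subseteq> U \<inter> \<phi> -` ball q d"
    using op open_contains_cball by blast
  obtain C2 where C2: "C1_bounded_on (cball p r) \<phi> C2" "C2 > 0"
    using C1_bounded_on_compact[OF \<phi>_C1 compact_cball, of p r] r(2) by blast
  have inU: "x \<in> U" "\<phi> x \<in> ball q d" if "x \<in> ball p r" for x
    using that r(2) ball_subset_cball by blast+
  have inI: "\<phi> x $ 1 \<in> I" if "x \<in> ball p r" for x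
  proof -
    have "\<bar>q $ 1 - \<phi> x $ 1\<bar> \<le> norm (q - \<phi> x)" using component_le_norm_cart[of "q - \<phi> x" 1] by simp
    also have "\<dots> < d" using inU(2)[OF that] by (simp add: dist_norm)
    finally show ?thesis by (auto simp: I_def)
  qed
  \<comment> \<open>The 3 bounds the reflected value \<open>2 * g 0 - g (- s)\<close>. The constants
    \<open>C1\<close> and \<open>C2\<close> bound the derivatives of \<open>\<psi>\<close> and
    \<open>\<phi>\<close>, which multiply in the chain rule.\<close>
  have "\<exists>F. C1_bounded_on (ball p r) F ((3 + C1 * C2) * b) \<and> (\<forall>x\<in>M \<inter> ball p r. F x = f x)"
    if f: "f \<in> C1_mfd M" and b: "\<forall>x\<in>M. \<bar>f x\<bar> \<le> b \<and> norm (tangential_gradient M f x) \<le> b" for f b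
  proof -
    have b0: "b \<ge> 0" using b p by force
    define G where "G = tangential_gradient M f"
    have G: "continuous_on M G" "\<And>x. x \<in> M \<Longrightarrow> has_tangential_gradient M f x (G x)"
      using f by (auto simp: C1_mfd_iff G_def)
    define g where "g = (\<lambda>s. f (\<psi> (hpt s)))"
    define g' where "g' = (\<lambda>s. G (\<psi> (hpt s)) \<bullet> \<psi>' (hpt s) (axis 1 1))"
    define e where "e = (\<lambda>s. if s \<ge> 0 then g s else 2 * g 0 - g (- s))"
    have \<gamma>M: "\<psi> (hpt s) \<in> M" if "s \<in> I \<inter> {0..}" for s using that hV curve_in_M by auto
    have g: "(g has_real_derivative g' s) (at s within I \<inter> {0..})" if "s \<in> I \<inter> {0..}" for s
      unfolding g_def g'_def
      by (rule function_along_curve_deriv[OF G(2)[OF \<gamma>M[OF that]] that]) (use hV in auto)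
    have e: "(e has_real_derivative g' \<bar>s\<bar>) (at s)" if "s \<in> I" for s
      unfolding e_def by (rule odd_reflection_has_derivative[OF I g that])
    have hpt_cont: "continuous_on S hpt" for S unfolding hpt_def by (intro continuous_intros)
    have "continuous_on (I \<inter> {0..}) g'"
    proof -
      have *: "continuous_on (I \<inter> {0..}) (\<lambda>s. \<psi> (hpt s))"
        by (rule continuous_on_compose2[OF C1_on_continuous_on[OF \<psi>_C1] hpt_cont]) (use hV in auto)
      show ?thesis unfolding g'_def
        by (intro continuous_intros continuous_on_compose2[OF G(1) *]
            continuous_on_compose2[OF C1_on_continuous_on[OF \<psi>'_C1] hpt_cont]) (use hV \<gamma>M in auto)
    qed
    then have g'_cont: "continuous_on I (\<lambda>s. g' \<bar>s\<bar>)"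
      by (rule continuous_on_compose2) (use I(2) in \<open>auto intro!: continuous_intros\<close>)
    have g_bnd: "\<bar>g s\<bar> \<le> b" if "s \<in> I \<inter> {0..}" for s using b \<gamma>M[OF that] by (simp add: g_def)
    have g'_bnd: "\<bar>g' s\<bar> \<le> b * C1" if "s \<in> I \<inter> {0..}" for s
    proof -
      have "\<bar>g' s\<bar> \<le> norm (G (\<psi> (hpt s))) * norm (\<psi>' (hpt s) (axis 1 1))"
        unfolding g'_def by (rule Cauchy_Schwarz_ineq2)
      also have "\<dots> \<le> b * C1"
      proof (rule mult_mono)
        show "norm (G (\<psi> (hpt s))) \<le> b" using b \<gamma>M[OF that] by (simp add: G_def)
        have "norm (\<psi>' (hpt s) (axis 1 1)) \<le> norm (\<psi>' (hpt s)) * norm (axis 1 1 :: real^2)" by (rule norm_blinfun)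
        then show "norm (\<psi>' (hpt s) (axis 1 1)) \<le> C1" using C1(2)[OF hI, of s] that by simp
      qed (use b0 in auto)
      finally show ?thesis .
    qed
    have e_bnd: "\<bar>e s\<bar> \<le> 3 * b" if "s \<in> I" for s
    proof (cases "s \<ge> 0")
      case True
      then show ?thesis using g_bnd[of s] that b0 by (auto simp: e_def)
    next
      case False
      then have "q $ 1 = 0" using that d(3) by (auto simp: I_def)
      then have "0 \<in> I" using d(1) by (simp add: I_def)
      then show ?thesis using False g_bnd[of 0] g_bnd[of "- s"] I(2)[OF that] by (auto simp: e_def)
    qed
    define F where "F = (\<lambda>x. e (\<phi> x $ 1))"
    have "C1_bounded_on (ball p r) F ((3 + C1 * C2) * b)"
    proof (rule C1_bounded_onI)
      fix x assume x: "x \<in> ball p r"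
      have "((\<lambda>x. \<phi> x $ 1) has_derivative (\<lambda>h. \<phi>' x h $ 1)) (at x)"
        by (rule bounded_linear.has_derivative[OF bounded_linear_vec_nth \<phi>_deriv[OF inU(1)[OF x]]])
      from has_derivative_compose[OF this e[OF inI[OF x], unfolded has_field_derivative_def]]
      show "(F has_derivative (\<lambda>h. g' \<bar>\<phi> x $ 1\<bar> * (\<phi>' x h $ 1))) (at x)" by (simp add: F_def)
      have "3 * b \<le> (3 + C1 * C2) * b" using b0 C1(1) C2(2) by (simp add: algebra_simps)
      then show "norm (F x) \<le> (3 + C1 * C2) * b" using e_bnd[OF inI[OF x]] by (simp add: F_def)
      fix h
      have "\<bar>\<phi>' x h $ 1\<bar> \<le> norm (\<phi>' x h)" by (rule component_le_norm_cart)
      also have "\<dots> \<le> C2 * norm h"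
        using C2(1) subsetD[OF ball_subset_cball x] frechet_\<phi>[OF inU(1)[OF x]] unfolding C1_bounded_on_def by metis
      finally have "\<bar>g' \<bar>\<phi> x $ 1\<bar>\<bar> * \<bar>\<phi>' x h $ 1\<bar> \<le> (b * C1) * (C2 * norm h)"
        by (intro mult_mono g'_bnd) (use I(2) inI[OF x] b0 C1(1) in auto)
      also have "\<dots> \<le> (3 + C1 * C2) * b * norm h" using b0 by (simp add: algebra_simps)
      finally show "norm (g' \<bar>\<phi> x $ 1\<bar> * (\<phi>' x h $ 1)) \<le> (3 + C1 * C2) * b * norm h"
        by (simp add: abs_mult)
    next
      fix h
      have \<phi>_cont: "continuous_on (ball p r) \<phi>" "continuous_on (ball p r) \<phi>'"
        using continuous_on_subset[OF C1_on_continuous_on[OF \<phi>_C1]] 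
          continuous_on_subset[OF C1_on_continuous_on[OF \<phi>'_C1]] inU(1) by blast+
      have "continuous_on (ball p r) (\<lambda>x. g' \<bar>\<phi> x $ 1\<bar>)"
        by (rule continuous_on_compose2[OF g'_cont]) (use inI \<phi>_cont in \<open>auto intro!: continuous_on_component\<close>)
      moreover have "continuous_on (ball p r) (\<lambda>x. \<phi>' x h $ 1)"
        by (intro continuous_on_component continuous_intros \<phi>_cont)
      ultimately show "continuous_on (ball p r) (\<lambda>x. g' \<bar>\<phi> x $ 1\<bar> * (\<phi>' x h $ 1))"
        by (rule continuous_on_mult)
    qed
    moreover have "F x = f x" if "x \<in> M \<inter> ball p r" for x
    proof -
      have x: "x \<in> U" "x \<in> M" using that inU by auto
      then show ?thesis
        using M_iff[OF x(1)] hpt_eqI[of "\<phi> x"] \<psi>_\<phi>[OF x(1)] by (simp add: F_def e_def g_def)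
    qed
    ultimately show ?thesis by blast
  qed
  moreover have "3 + C1 * C2 \<ge> 0" using C1 C2 by simp
  ultimately show ?thesis using r(1) by blast
qed

text \<open>\<open>S\<close> is the region in which agreement with \<open>f\<close> has been
  reached; it grows ball by ball. \<open>K\<close> and \<open>C\<close> are fixed before
  \<open>f\<close>, which is the uniformity that continuity of \<open>h\<close> rests on. A free
  bound \<open>b\<close> keeps suprema out of the patching.\<close>

definition (in normal_curve) extends_on :: "(real^2) set \<Rightarrow> (real^2) set \<Rightarrow> bool" where
  "extends_on D S \<longleftrightarrow> (\<exists>K C. compact K \<and> K \<subseteq> D \<and> C \<ge> 0 \<and>
     (\<forall>f\<in>C1_mfd M. \<forall>b. (\<forall>x\<in>M. \<bar>f x\<bar> \<le> b \<and> norm (tangential_gradient M f x) \<le> b) \<longrightarrow>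
       (\<exists>F. C1_bounded_on UNIV F (C * b) \<and> (\<forall>x\<in>M \<inter> S. F x = f x) \<and> (\<forall>x. x \<notin> K \<longrightarrow> F x = 0))))"

text \<open>Patching by \<open>c F\<^sub>0 + (1 - c) F\<^sub>1\<close> with a cutoff \<open>c\<close> that is 1 near \<open>p\<close> replaces a partition of
  unity.\<close>

lemma (in normal_curve) extends_on_ball_Un:
  assumes p: "p \<in> M" and D: "open D" "M \<subseteq> D"
  shows "\<exists>\<rho>>0. \<forall>S. extends_on D S \<longrightarrow> extends_on D (ball p \<rho> \<union> S)"
proof -
  obtain r0 C0 where r0: "r0 > 0" "C0 \<ge> 0" and ext0: "\<And>f b. f \<in> C1_mfd M \<Longrightarrow> 
      (\<And>x. x \<in> M \<Longrightarrow> \<bar>f x\<bar> \<le> b \<and> norm (tangential_gradient M f x) \<le> b) \<Longrightarrow>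
      \<exists>F. C1_bounded_on (ball p r0) F (C0 * b) \<and> (\<forall>x\<in>M \<inter> ball p r0. F x = f x)"
    using C1_mfd_local_extension[OF p] by blast
  obtain R where R: "R > 0" "cball p R \<subseteq> D" using D p open_contains_cball by blast
  define r where "r = min r0 R"
  have r: "r > 0" "ball p r \<subseteq> ball p r0" "cball p r \<subseteq> D"
    using r0 R by (auto simp: r_def)
  have r3: "0 < r/3" "r/3 < r/2" using r(1) by auto
  obtain c :: "real^2 \<Rightarrow> real" where c: "C1_on UNIV c" "\<And>x. dist p x \<le> r/3 \<Longrightarrow> c x = 1" "\<And>x. dist p x \<ge> r/2 \<Longrightarrow> c x = 0"
    using C1_cutoff[OF r3, of p] by (metis (no_types, lifting))
  have c0: "c x = 0" if "x \<notin> cball p (r/2)" for x using c(3) that by simp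
  obtain B where B: "C1_bounded_on UNIV c B" "B > 0"
    by (rule C1_bounded_on_UNIV[OF c(1) compact_cball c0])
  obtain B' where B': "C1_bounded_on UNIV (\<lambda>x. 1 - c x) B'" "B' > 0"
  proof -
    have "C1_on UNIV (\<lambda>x. 1 - c x)" by (intro C1_on_diff C1_on_const c(1))
    then show ?thesis
      by (rule C1_bounded_on_UNIV[OF _ compact_cball[of p "r/2"], of _ 1]) (simp_all add: c0 that)
  qed
  show ?thesis
  proof (intro exI[of _ "r/3"] conjI allI impI)
    show "r/3 > 0" using r by simp
    fix S assume "extends_on D S"
    then obtain K C where K: "compact K" "K \<subseteq> D" "C \<ge> 0"
      and ext: "\<forall>f\<in>C1_mfd M. \<forall>b. (\<forall>x\<in>M. \<bar>f x\<bar> \<le> b \<and> norm (tangential_gradient M f x) \<le> b) \<longrightarrow>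
       (\<exists>F. C1_bounded_on UNIV F (C * b) \<and> (\<forall>x\<in>M \<inter> S. F x = f x) \<and> (\<forall>x. x \<notin> K \<longrightarrow> F x = 0))"
      unfolding extends_on_def by - (elim exE conjE, rule that)
    define C' where "C' = 2 * B * C0 + 2 * B' * C"
    have "\<exists>F. C1_bounded_on UNIV F (C' * b) \<and> (\<forall>x\<in>M \<inter> (ball p (r/3) \<union> S). F x = f x) \<and> (\<forall>x. x \<notin> K \<union> cball p r \<longrightarrow> F x = 0)"
      if f: "f \<in> C1_mfd M" and b: "\<forall>x\<in>M. \<bar>f x\<bar> \<le> b \<and> norm (tangential_gradient M f x) \<le> b" for f b
    proof -
      obtain F1 where F1: "C1_bounded_on UNIV F1 (C * b)" "\<forall>x\<in>M \<inter> S. F1 x = f x" "\<forall>x. x \<notin> K \<longrightarrow> F1 x = 0"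
        using ext f b by blast
      obtain F0 where F0: "C1_bounded_on (ball p r0) F0 (C0 * b)" "\<forall>x\<in>M \<inter> ball p r0. F0 x = f x"
        using ext0[OF f] b by blast
      have b0: "b \<ge> 0" using b p by force
      \<comment> \<open>Nothing is known of \<open>F0\<close> outside its ball, so the product is
        set to 0 there by hand. It is already 0 beyond \<open>r/2\<close>, hence the two formulas
        agree on an overlap of two open sets that cover the plane.\<close>
      define P where "P = (\<lambda>x. if x \<in> ball p r then c x * F0 x else 0)"
      have "C1_bounded_on (ball p r) (\<lambda>x. c x *\<^sub>R F0 x) (2 * B * (C0 * b))"
        by (intro C1_bounded_on_scaleR C1_bounded_on_mono[OF B(1)] C1_bounded_on_mono[OF F0(1)]) (use r in auto)
      then have "C1_bounded_on (ball p r) P (2 * B * (C0 * b))"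
        by (rule C1_bounded_on_cong_open) (auto simp: P_def)
      moreover have "C1_bounded_on (- cball p (r/2)) P (2 * B * (C0 * b))"
      proof (rule C1_bounded_on_cong_open)
        show "C1_bounded_on (- cball p (r/2)) (\<lambda>_. 0) (2 * B * (C0 * b))"
          by (rule C1_bounded_onI[where f' = "\<lambda>_ _. 0"]) (use B b0 r0 in auto)
      qed (auto simp: P_def c0 open_Compl)
      ultimately have "C1_bounded_on (ball p r \<union> - cball p (r/2)) P (2 * B * (C0 * b))"
        by (rule C1_bounded_on_Un) (auto simp: open_Compl)
      moreover have "ball p r \<union> - cball p (r/2) = UNIV" using r(1) by auto
      ultimately have P: "C1_bounded_on UNIV P (2 * B * (C0 * b))" by simp
      define F where "F = (\<lambda>x. P x + (1 - c x) *\<^sub>R F1 x)"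
      have "C1_bounded_on UNIV F (2 * B * (C0 * b) + 2 * B' * (C * b))"
        unfolding F_def by (intro C1_bounded_on_add C1_bounded_on_scaleR P B' F1(1))
      then have "C1_bounded_on UNIV F (C' * b)" by (simp add: C'_def algebra_simps)
      moreover have "F x = f x" if x: "x \<in> M \<inter> (ball p (r/3) \<union> S)" for x
      proof (cases "x \<in> ball p (r/3)")
        case True
        then have "c x = 1" "x \<in> ball p r" using c(2) r(1) by auto
        then show ?thesis using F0(2) x r(2) by (auto simp: F_def P_def)
      next
        case False
        then have F1x: "F1 x = f x" using F1(2) x by blast
        show ?thesis
        proof (cases "x \<in> ball p r")
          case True
          then have "F0 x = f x" using F0(2) x r(2) by blast
          then show ?thesis using True F1x by (simp add: F_def P_def algebra_simps)
        next
          case False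
          then have "c x = 0" using c(3) r(1) by simp
          then show ?thesis using False F1x by (simp add: F_def P_def)
        qed
      qed
      moreover have "F x = 0" if "x \<notin> K \<union> cball p r" for x
        using that F1(3) by (auto simp: F_def P_def)
      ultimately show ?thesis by blast
    qed
    moreover have "compact (K \<union> cball p r)" "K \<union> cball p r \<subseteq> D" "C' \<ge> 0"
      using K r(3) B B' r0 by (auto simp: C'_def compact_Un)
    ultimately show "extends_on D (ball p (r/3) \<union> S)"
      unfolding extends_on_def by (intro exI[of _ "K \<union> cball p r"] exI[of _ C']) auto
  qed
qed

text \<open>A \<open>SUP\<close> dominates the values only over a set bounded above; continuity on
  the compact \<open>M\<close> ensures this for the function and its gradient.\<close>

lemma (in normal_curve) C1_mfd_norm_bounds:
  assumes "compact M" and f: "f \<in> C1_mfd M" and x: "x \<in> M"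
  shows "\<bar>f x\<bar> \<le> C1_mfd_norm M f" "norm (tangential_gradient M f x) \<le> C1_mfd_norm M f"
proof -
  have G: "continuous_on M (tangential_gradient M f)"
    and "\<And>p. p \<in> M \<Longrightarrow> has_tangential_gradient M f p (tangential_gradient M f p)"
    using f by (auto simp: C1_mfd_iff)
  then have "continuous_on M f"
    unfolding has_tangential_gradient_def continuous_on_eq_continuous_within
    using has_derivative_continuous by blast
  then have 1: "bdd_above ((\<lambda>p. \<bar>f p\<bar>) ` M)"
    by (intro bounded_imp_bdd_above compact_imp_bounded compact_continuous_image assms continuous_intros)
  have 2: "bdd_above ((\<lambda>p. norm (tangential_gradient M f p)) ` M)"
    by (intro bounded_imp_bdd_above compact_imp_bounded compact_continuous_image assms continuous_intros G)
  have "\<bar>f x\<bar> \<le> (SUP p\<in>M. \<bar>f p\<bar>)" "norm (tangential_gradient M f x) \<le> (SUP p\<in>M. norm (tangential_gradient M f p))"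
    by (rule cSUP_upper[OF x 1], rule cSUP_upper[OF x 2])
  moreover have "0 \<le> \<bar>f x\<bar>" "0 \<le> norm (tangential_gradient M f x)" by auto
  ultimately show "\<bar>f x\<bar> \<le> C1_mfd_norm M f" "norm (tangential_gradient M f x) \<le> C1_mfd_norm M f"
    unfolding C1_mfd_norm_def by linarith+
qed

text \<open>Finitely many balls cover \<open>M\<close>, and each enlarges the region of agreement by
  one patching, starting from the zero function for the empty region. The common bound
  \<open>b\<close> is finally taken to be the norm of \<open>f\<close>.\<close>

lemma (in normal_curve) C1_mfd_extension:
  assumes M: "compact M" and D: "open D" "M \<subseteq> D"
  obtains K C E where "compact K" "K \<subseteq> D" "C \<ge> 0"
    "\<And>f. f \<in> C1_mfd M \<Longrightarrow> C1_bounded_on UNIV (E f) (C * C1_mfd_norm M f)"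
    "\<And>f x. f \<in> C1_mfd M \<Longrightarrow> x \<in> M \<Longrightarrow> E f x = f x"
    "\<And>f x. f \<in> C1_mfd M \<Longrightarrow> x \<notin> K \<Longrightarrow> E f x = 0"
proof -
  have "\<forall>p\<in>M. \<exists>\<rho>>0. \<forall>S. extends_on D S \<longrightarrow> extends_on D (ball p \<rho> \<union> S)"
    using extends_on_ball_Un[OF _ D] by blast
  from bchoice[OF this] obtain \<rho> where
    \<rho>: "\<And>p. p \<in> M \<Longrightarrow> \<rho> p > 0" "\<And>p S. p \<in> M \<Longrightarrow> extends_on D S \<Longrightarrow> extends_on D (ball p (\<rho> p) \<union> S)"
    by blast
  have cover: "M \<subseteq> (\<Union>p\<in>M. ball p (\<rho> p))" using \<rho>(1) centre_in_ball by blast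
  obtain T where T: "T \<subseteq> M" "finite T" "M \<subseteq> (\<Union>p\<in>T. ball p (\<rho> p))"
    by (rule compactE_image[OF M open_ball cover])
  have "extends_on D (\<Union>p\<in>T. ball p (\<rho> p))"
    using T(2,1)
  proof (induction T)
    case empty
    have "C1_bounded_on UNIV (\<lambda>_::real^2. 0::real) 0"
      by (rule C1_bounded_onI[where f' = "\<lambda>_ _. 0"]) auto
    then show ?case unfolding extends_on_def
      by (intro exI[of _ "{}"] exI[of _ 0]) auto
  next
    case (insert p T)
    then show ?case using \<rho>(2) by simp
  qed
  then obtain K C where K: "compact K" "K \<subseteq> D" "C \<ge> 0" and
     F: "\<forall>f\<in>C1_mfd M. \<forall>b. (\<forall>x\<in>M. \<bar>f x\<bar> \<le> b \<and> norm (tangential_gradient M f x) \<le> b) \<longrightarrow>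
       (\<exists>F. C1_bounded_on UNIV F (C * b) \<and> (\<forall>x\<in>M \<inter> (\<Union>p\<in>T. ball p (\<rho> p)). F x = f x) \<and> (\<forall>x. x \<notin> K \<longrightarrow> F x = 0))"
    unfolding extends_on_def by - (elim exE conjE, rule that)
  have "M \<inter> (\<Union>p\<in>T. ball p (\<rho> p)) = M" using T(3) by blast
  then have "\<forall>f\<in>C1_mfd M. \<exists>F. C1_bounded_on UNIV F (C * C1_mfd_norm M f) \<and> (\<forall>x\<in>M. F x = f x) \<and> (\<forall>x. x \<notin> K \<longrightarrow> F x = 0)"
    using F C1_mfd_norm_bounds[OF M] by simp
  from bchoice[OF this] obtain E where "\<forall>f\<in>C1_mfd M. C1_bounded_on UNIV (E f) (C * C1_mfd_norm M f) \<and>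
      (\<forall>x\<in>M. E f x = f x) \<and> (\<forall>x. x \<notin> K \<longrightarrow> E f x = 0)" by blast
  then show ?thesis by (intro that[OF K, of E]) auto
qed

section \<open>Continuous linear functionals\<close>

lemma linear_functional_on_diff:
  assumes L: "linear_functional_on V L" and "f \<in> V" "g \<in> V" "(\<lambda>x. f x - g x) \<in> V"
  shows "L (\<lambda>x. f x - g x) = L f - L g"
proof -
  have "L (\<lambda>x. (f x - g x) + g x) = L (\<lambda>x. f x - g x) + L g"
    using conjunct1[OF L[unfolded linear_functional_on_def], rule_format, OF assms(4,3)] .
  then show ?thesis by simp
qed

lemma linear_functional_on_zero:
  assumes L: "linear_functional_on V L" and f: "f \<in> V"
  shows "L (\<lambda>_. 0) = 0"
proof -
  have "L (\<lambda>x. 0 *\<^sub>R f x) = 0 * L f" using assms unfolding linear_functional_on_def by blast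
  then show ?thesis by simp
qed

text \<open>The linear bound makes \<open>L\<close> Lipschitz with respect to \<open>p\<close>. The
  condition \<open>p0\<close> puts the centre into each ball, so the balls exhaust \<open>V\<close>
  and serve as neighbourhoods.\<close>

lemma continuous_map_seminorm_topology:
  assumes L: "linear_functional_on V L" and V: "\<And>f g. f \<in> V \<Longrightarrow> g \<in> V \<Longrightarrow> (\<lambda>x. f x - g x) \<in> V"
    and p0: "p (\<lambda>_. 0) = 0" and C: "C \<ge> 0" and bnd: "\<And>f. f \<in> V \<Longrightarrow> \<bar>L f\<bar> \<le> C * p f"
  shows "continuous_map (seminorm_topology V {p}) euclideanreal L"
proof -
  have basic: "openin (seminorm_topology V {p}) {f \<in> V. p (\<lambda>x. f x - g x) < e}" if "g \<in> V" "e > 0" for g e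
    unfolding seminorm_topology_def by (rule topology_generated_by_Basis) (use that in blast)
  have self: "f \<in> {g \<in> V. p (\<lambda>x. g x - f x) < e}" if "f \<in> V" "e > 0" for f e
    using that p0 by simp
  have top: "topspace (seminorm_topology V {p}) = V"
  proof
    show "topspace (seminorm_topology V {p}) \<subseteq> V"
      unfolding seminorm_topology_def topology_generated_by_topspace by blast
    show "V \<subseteq> topspace (seminorm_topology V {p})"
      using openin_subset[OF basic[OF _ zero_less_one]] self[OF _ zero_less_one] by blast
  qed
  have "openin (seminorm_topology V {p}) {f \<in> V. L f \<in> U}" if U: "open U" for U
    unfolding openin_subopen[of _ "{f \<in> V. L f \<in> U}"]
  proof
    fix f assume f: "f \<in> {f \<in> V. L f \<in> U}"
    then obtain d where d: "d > 0" "\<And>y. dist y (L f) < d \<Longrightarrow> y \<in> U"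
      using U unfolding open_dist by blast
    \<comment> \<open>Dividing by \<open>C + 1\<close> covers \<open>C = 0\<close> and leaves room
      for the strict inequality.\<close>
    define e where "e = d / (C + 1)"
    have e: "e > 0" using d C by (simp add: e_def)
    have "L g \<in> U" if g: "g \<in> V" "p (\<lambda>x. g x - f x) < e" for g
    proof -
      have fV: "f \<in> V" using f by blast
      have "\<bar>L g - L f\<bar> = \<bar>L (\<lambda>x. g x - f x)\<bar>"
        using linear_functional_on_diff[OF L g(1) fV V[OF g(1) fV]] by simp
      also have "\<dots> \<le> C * p (\<lambda>x. g x - f x)" by (rule bnd[OF V[OF g(1) fV]])
      also have "\<dots> \<le> C * e" using g(2) C by (intro mult_left_mono) auto
      also have "\<dots> < d" using d C by (simp add: e_def field_simps)
      finally show ?thesis by (intro d(2)) (simp add: dist_real_def)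
    qed
    then show "\<exists>T. openin (seminorm_topology V {p}) T \<and> f \<in> T \<and> T \<subseteq> {f \<in> V. L f \<in> U}"
      using f e basic[of f e] self[of f e] by (intro exI[of _ "{g \<in> V. p (\<lambda>x. g x - f x) < e}"]) auto
  qed
  then show ?thesis by (simp add: continuous_map_def top)
qed

lemma (in normal_curve) C1_mfd_norm_zero:
  assumes "M \<noteq> {}"
  shows "C1_mfd_norm M (\<lambda>_. 0) = 0"
proof -
  have "tangential_gradient M (\<lambda>_. 0) p = 0" if "p \<in> M" for p
    by (rule tangential_gradient_eq[OF that])
      (simp add: has_tangential_gradient_def tangent_space_iff[OF that])
  then show ?thesis using assms by (simp add: C1_mfd_norm_def)
qed

section \<open>Compactly supported C1 fields and their topology\<close>

lemma C1cI:
  assumes X: "C1_on UNIV X" and K: "compact K" "K \<subseteq> D" "\<And>x. x \<notin> K \<Longrightarrow> X x = 0"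
  shows "X \<in> C1c D"
proof -
  have "closure {x. X x \<noteq> 0} \<subseteq> K"
    by (rule closure_minimal) (use K compact_imp_closed in blast)+
  moreover from this have "compact (closure {x. X x \<noteq> 0})"
    using K(1) by (metis closed_Int_compact closed_closure inf.absorb1)
  ultimately show ?thesis using X K(2) by (auto simp: C1c_def)
qed

lemma C1cE:
  assumes "X \<in> C1c D"
  obtains K where "C1_on UNIV X" "compact K" "K \<subseteq> D" "\<And>x. x \<notin> K \<Longrightarrow> X x = 0"
  using assms closure_subset[of "{x. X x \<noteq> 0}"] unfolding C1c_def by blast

lemma C1c_add:
  assumes "X \<in> C1c D" "Y \<in> C1c D"
  shows "(\<lambda>x. X x + Y x) \<in> C1c D"
proof -
  obtain K where K: "C1_on UNIV X" "compact K" "K \<subseteq> D" "\<And>x. x \<notin> K \<Longrightarrow> X x = 0" using C1cE[OF assms(1)] by blast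
  obtain K' where K': "C1_on UNIV Y" "compact K'" "K' \<subseteq> D" "\<And>x. x \<notin> K' \<Longrightarrow> Y x = 0" using C1cE[OF assms(2)] by blast
  show ?thesis
    by (rule C1cI[of _ "K \<union> K'"]) (use K K' in \<open>auto intro: C1_on_add\<close>)
qed

lemma C1c_scaleR:
  assumes "X \<in> C1c D"
  shows "(\<lambda>x. c *\<^sub>R X x) \<in> C1c D"
proof -
  obtain K where K: "C1_on UNIV X" "compact K" "K \<subseteq> D" "\<And>x. x \<notin> K \<Longrightarrow> X x = 0" using C1cE[OF assms] by blast
  show ?thesis
    by (rule C1cI[of _ K]) (use K in \<open>auto intro: C1_on_scaleR C1_on_const\<close>)
qed

lemma C1c_diff: "X \<in> C1c D \<Longrightarrow> Y \<in> C1c D \<Longrightarrow> (\<lambda>x. X x - Y x) \<in> C1c D"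
  using C1c_add[of X D "\<lambda>x. - 1 *\<^sub>R Y x"] C1c_scaleR[of Y D "- 1"] by simp

lemma partial_deriv_diff:
  assumes "C1_on UNIV X" "C1_on UNIV Y"
  shows "partial_deriv \<alpha> (\<lambda>x. X x - Y x) x = partial_deriv \<alpha> X x - partial_deriv \<alpha> Y x"
proof -
  have "frechet_derivative (\<lambda>x. X x - Y x) (at x) = (\<lambda>h. frechet_derivative X (at x) h - frechet_derivative Y (at x) h)"
    by (intro frechet_derivative_eq has_derivative_diff C1_on_has_derivative[OF assms(1)] C1_on_has_derivative[OF assms(2)]) auto
  then show ?thesis by (simp add: partial_deriv_def split: option.split)
qed

lemma norm_partial_deriv_le:
  assumes "C1_bounded_on UNIV X B"
  shows "norm (partial_deriv \<alpha> X x) \<le> B"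
proof -
  have "norm (frechet_derivative X (at x) (axis i 1)) \<le> B * norm (axis i 1 :: real^2)" for i
    using assms unfolding C1_bounded_on_def by blast
  moreover have "norm (X x) \<le> B" using assms unfolding C1_bounded_on_def by blast
  ultimately show ?thesis by (simp add: partial_deriv_def split: option.split)
qed

lemma norm_partial_deriv_le_seminorm:
  assumes X: "C1_on UNIV X" and K: "compact K" "x \<in> K"
  shows "norm (partial_deriv \<alpha> X x) \<le> C1c_seminorm K \<alpha> X"
proof -
  have "continuous_on K (partial_deriv \<alpha> X)"
    using continuous_on_subset[OF C1_on_continuous_on[OF X]] continuous_on_subset[OF C1_on_continuous_deriv[OF X]]
    by (cases \<alpha>) (simp_all add: partial_deriv_def[abs_def])
  then have "bdd_above ((\<lambda>x. norm (partial_deriv \<alpha> X x)) ` K)"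
    by (intro bounded_imp_bdd_above compact_imp_bounded compact_continuous_image K continuous_intros)
  then show ?thesis unfolding C1c_seminorm_def by (rule cSUP_upper[OF K(2)])
qed

text \<open>Each seminorm is dominated by the C1 bound on the plane, so every neighbourhood of 0 in
  the generated topology contains a C1 ball. The induction follows the generation of open sets from
  the subbasis.\<close>

lemma C1c_topology_zero_nbhd:
  assumes S: "openin (C1c_topology D) S" and zero: "(\<lambda>_. 0) \<in> S"
  shows "\<exists>\<delta>>0. \<forall>X\<in>C1c D. C1_bounded_on UNIV X \<delta> \<longrightarrow> X \<in> S"
proof -
  have "generate_topology_on {{f \<in> C1c D. p (\<lambda>x. f x - g x) < e} | p g e.
      p \<in> {C1c_seminorm K \<alpha> | K \<alpha>. compact K \<and> K \<noteq> {} \<and> K \<subseteq> D} \<and> g \<in> C1c D \<and> e > 0} S"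
    using S unfolding C1c_topology_def seminorm_topology_def openin_topology_generated_by_iff .
  then show ?thesis using zero
  proof induction
    case Empty
    then show ?case by simp
  next
    case (Int a b)
    then obtain d1 d2 where "d1 > 0" "\<forall>X\<in>C1c D. C1_bounded_on UNIV X d1 \<longrightarrow> X \<in> a"
      "d2 > 0" "\<forall>X\<in>C1c D. C1_bounded_on UNIV X d2 \<longrightarrow> X \<in> b" by blast
    moreover have "C1_bounded_on UNIV X d1 \<and> C1_bounded_on UNIV X d2"
      if "C1_bounded_on UNIV X (min d1 d2)" for X :: "real^2 \<Rightarrow> real^2"
      using C1_bounded_on_mono[OF that] by simp
    ultimately show ?case by (intro exI[of _ "min d1 d2"]) auto
  next
    case (UN K)
    then obtain k where "k \<in> K" "(\<lambda>_. 0) \<in> k" by blast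
    then show ?case using UN.IH[of k] by blast
  next
    case (Basis s)
    then obtain K \<alpha> g e where s: "s = {f \<in> C1c D. C1c_seminorm K \<alpha> (\<lambda>x. f x - g x) < e}"
      and K: "compact K" "K \<noteq> {}" and g: "g \<in> C1c D" by blast
    \<comment> \<open>Subbasic sets may be centred at any \<open>g\<close>, and \<open>t\<close>
      measures how far 0 is from it. Half of the slack \<open>e - t\<close> is kept so that the
      inequality remains strict after passing to the supremum.\<close>
    define t where "t = C1c_seminorm K \<alpha> (\<lambda>x. 0 - g x)"
    have t: "t < e" using Basis(2) unfolding s t_def by blast
    have g': "C1_on UNIV g" "C1_on UNIV (\<lambda>x. 0 - g x)"
      using g C1_on_diff[OF C1_on_const, of UNIV g 0] by (auto simp: C1c_def)
    have "X \<in> s" if X: "X \<in> C1c D" "C1_bounded_on UNIV X ((e - t) / 2)" for X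
    proof -
      have X': "C1_on UNIV X" using X(1) by (simp add: C1c_def)
      have "norm (partial_deriv \<alpha> (\<lambda>x. X x - g x) x) \<le> (e - t) / 2 + t" if x: "x \<in> K" for x
      proof -
        have "partial_deriv \<alpha> (\<lambda>x. X x - g x) x = partial_deriv \<alpha> X x + partial_deriv \<alpha> (\<lambda>x. 0 - g x) x"
          using partial_deriv_diff[OF X' g'(1)] partial_deriv_diff[OF C1_on_const g'(1), of \<alpha> 0 x]
            partial_deriv_diff[OF C1_on_const C1_on_const, of \<alpha> 0 0 x] by simp
        also have "norm \<dots> \<le> (e - t) / 2 + t"
          unfolding t_def by (rule norm_triangle_mono)
            (use norm_partial_deriv_le[OF X(2)] norm_partial_deriv_le_seminorm[OF g'(2) K(1) x] in \<open>auto simp: t_def\<close>)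
        finally show ?thesis .
      qed
      then have "C1c_seminorm K \<alpha> (\<lambda>x. X x - g x) \<le> (e - t) / 2 + t"
        unfolding C1c_seminorm_def using K(2) by (intro cSUP_least) auto
      also have "\<dots> < e" using t by (simp add: field_simps)
      finally show ?thesis using X(1) by (simp add: s)
    qed
    then show ?case using t by (intro exI[of _ "(e - t) / 2"]) auto
  qed
qed

text \<open>By homogeneity, a functional of modulus below 1 on the C1 ball of radius
  \<open>\<delta>\<close> is at most \<open>1 / \<delta>\<close> times the C1 bound of its argument.
  Continuity for a family of seminorms thus becomes one inequality.\<close>

lemma C1c_functional_bound:
  assumes D: "D \<noteq> {}" and lin: "linear_functional_on (C1c D) L"
    and cont: "continuous_map (C1c_topology D) euclideanreal L"
  obtains C where "C \<ge> 0" "\<And>X B. X \<in> C1c D \<Longrightarrow> C1_bounded_on UNIV X B \<Longrightarrow> \<bar>L X\<bar> \<le> C * B"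
proof -
  obtain a where a: "a \<in> D" using D by blast
  have zero: "(\<lambda>_. 0) \<in> C1c D" by (rule C1cI[OF C1_on_const, of "{}"]) auto
  define S where "S = {X \<in> topspace (C1c_topology D). L X \<in> {-1<..<1}}"
  have S: "openin (C1c_topology D) S"
    unfolding S_def by (rule openin_continuous_map_preimage[OF cont]) simp
  \<comment> \<open>The space of a generated topology is the union of its generators, so 0 must be
    found in one of them; a one-point compact set provides it.\<close>
  have "openin (C1c_topology D) {f \<in> C1c D. C1c_seminorm {a} None (\<lambda>x. f x - (\<lambda>_. 0) x) < 1}"
    unfolding C1c_topology_def seminorm_topology_def
    by (rule topology_generated_by_Basis, rule CollectI, rule exI[of _ "C1c_seminorm {a} None"],
        rule exI[of _ "\<lambda>_. 0"], rule exI[of _ 1]) (use a zero in auto)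
  then have "(\<lambda>_. 0) \<in> topspace (C1c_topology D)"
    using openin_subset zero by (fastforce simp: C1c_seminorm_def partial_deriv_def)
  then have "(\<lambda>_. 0) \<in> S" using linear_functional_on_zero[OF lin zero] by (simp add: S_def)
  then obtain \<delta> where \<delta>: "\<delta> > 0" "\<And>X. X \<in> C1c D \<Longrightarrow> C1_bounded_on UNIV X \<delta> \<Longrightarrow> X \<in> S"
    using C1c_topology_zero_nbhd[OF S] by blast
  have "\<bar>L X\<bar> \<le> 1 / \<delta> * B" if X: "X \<in> C1c D" "C1_bounded_on UNIV X B" for X B
  proof (rule field_le_epsilon)
    fix \<epsilon> :: real assume \<epsilon>: "\<epsilon> > 0"
    have "B \<ge> 0" using X(2) norm_ge_zero order_trans unfolding C1_bounded_on_def by blast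
    \<comment> \<open>\<open>B\<close> may be 0, so it is enlarged before the division; the excess
      adds exactly \<open>\<epsilon>\<close> to the final bound.\<close>
    define B' where "B' = B + \<epsilon> * \<delta>"
    have B': "B' > 0" "B \<le> B'" using \<open>B \<ge> 0\<close> \<epsilon> \<delta>(1) by (auto simp: B'_def add_nonneg_pos)
    define c where "c = \<delta> / B'"
    have c: "c > 0" using B' \<delta>(1) by (simp add: c_def)
    have "c * B \<le> c * B'" using B'(2) c by (intro mult_left_mono) auto
    also have "\<dots> = \<delta>" using B'(1) by (simp add: c_def)
    finally have "\<bar>c\<bar> * B \<le> \<delta>" using c by simp
    then have "C1_bounded_on UNIV (\<lambda>x. c *\<^sub>R X x) \<delta>"
      by (rule C1_bounded_on_mono[OF C1_bounded_on_const_scaleR[OF X(2)] subset_UNIV])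
    then have "(\<lambda>x. c *\<^sub>R X x) \<in> S" using \<delta>(2) C1c_scaleR[OF X(1)] by blast
    then have "\<bar>L (\<lambda>x. c *\<^sub>R X x)\<bar> < 1" by (auto simp: S_def abs_less_iff)
    moreover have "L (\<lambda>x. c *\<^sub>R X x) = c * L X" using lin X(1) unfolding linear_functional_on_def by blast
    ultimately have "c * \<bar>L X\<bar> < 1" using c by (simp add: abs_mult)
    then have "\<bar>L X\<bar> < B' / \<delta>" using B'(1) \<delta>(1) by (simp add: c_def field_simps)
    then show "\<bar>L X\<bar> \<le> 1 / \<delta> * B + \<epsilon>" using \<delta>(1) by (simp add: B'_def field_simps)
  qed
  then show ?thesis using that[of "1 / \<delta>"] \<delta>(1) by simp
qed

section \<open>The structure of the shape derivative\<close>

context normal_curve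
begin

lemma normal_extension:
  assumes "compact M" "open D" "M \<subseteq> D"
  obtains N B where "C1_bounded_on UNIV N B" "\<And>x. x \<in> M \<Longrightarrow> N x = n x"
proof -
  have "\<exists>F B. C1_bounded_on UNIV F B \<and> (\<forall>x\<in>M. F x = n x $ i)" for i
    by (rule C1_mfd_extension[OF assms]) (use normal_component_C1_mfd[of i] in force)
  then obtain F B where F: "\<And>i. C1_bounded_on UNIV (F i) (B i)" "\<And>i x. x \<in> M \<Longrightarrow> F i x = n x $ i" by metis
  have const: "C1_bounded_on UNIV (\<lambda>_::real^2. axis i 1 :: real^2) 1" for i
    by (rule C1_bounded_onI[where f' = "\<lambda>_ _. 0"]) auto
  have "C1_bounded_on UNIV (\<lambda>x. F 1 x *\<^sub>R axis 1 1 + F 2 x *\<^sub>R axis 2 1 :: real^2) (2 * B 1 * 1 + 2 * B 2 * 1)"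
    by (intro C1_bounded_on_add C1_bounded_on_scaleR F(1) const)
  moreover have "F 1 x *\<^sub>R axis 1 1 + F 2 x *\<^sub>R axis 2 1 = n x" if "x \<in> M" for x
    by (simp add: F(2)[OF that] vec_eq_iff forall_2 axis_def)
  ultimately show ?thesis by (rule that)
qed

text \<open>These fields detect a single tip. The direction \<open>rot N\<close> is tangent on
  \<open>M\<close>, and a cutoff whose radius is at most \<open>dist a b\<close> makes the field
  vanish at \<open>b\<close>.\<close>

lemma tangential_field:
  assumes N: "C1_on UNIV N" "\<And>x. x \<in> M \<Longrightarrow> N x = n x" and "open D" "M \<subseteq> D"
    and a: "a \<in> M" "a \<noteq> b" and v: "v \<bullet> n a = 0"
  obtains Y where "Y \<in> C1c D" "\<And>x. x \<in> M \<Longrightarrow> Y x \<bullet> n x = 0" "Y a = v" "Y b = 0"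
proof -
  obtain R where R: "R > 0" "cball a R \<subseteq> D" using assms open_contains_cball by blast
  define r where "r = min R (dist a b)"
  have "r > 0" using R a by (simp add: r_def)
  then have r: "0 < r/2" "r/2 < r" by auto
  have rR: "cball a r \<subseteq> D" "r \<le> dist a b" using R(2) by (auto simp: r_def)
  obtain c :: "real^2 \<Rightarrow> real" where c: "C1_on UNIV c" "\<And>x. dist a x \<le> r/2 \<Longrightarrow> c x = 1" "\<And>x. dist a x \<ge> r \<Longrightarrow> c x = 0"
    using C1_cutoff[OF r(1,2), of a] by (metis (no_types, lifting))
  define s where "s = v \<bullet> rot (n a)"
  define Y where "Y = (\<lambda>x. (c x * s) *\<^sub>R rot (N x))"
  show ?thesis
  proof
    have "C1_on UNIV (\<lambda>x. rot (N x))"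
      by (rule C1_on_compose[OF C1_on_bounded_linear[OF bounded_linear_rot, of UNIV] N(1)]) simp
    then have "C1_on UNIV Y" unfolding Y_def
      by (intro C1_on_scaleR C1_on_mult C1_on_const c)
    then show "Y \<in> C1c D"
      by (rule C1cI[of _ "cball a r"]) (use rR c(3) in \<open>auto simp: Y_def\<close>)
    show "Y x \<bullet> n x = 0" if "x \<in> M" for x by (simp add: Y_def N(2)[OF that] rot_orth)
    show "Y a = v" using orth_n[OF a(1) v] c(2)[of a] r by (simp add: Y_def N(2)[OF a(1)] s_def)
    show "Y b = 0" using c(3)[OF rR(2)] by (simp add: Y_def)
  qed
qed

text \<open>\<open>v\<close> is \<open>rot (n a)\<close> up to sign, and the sign cancels because
  \<open>v\<close> occurs twice.\<close>

lemma endpoint_decomposition: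
  assumes "a \<in> M" "norm v = 1" "v \<bullet> n a = 0"
  shows "(w \<bullet> v) *\<^sub>R v + (w \<bullet> n a) *\<^sub>R n a = w"
proof -
  define s where "s = v \<bullet> rot (n a)"
  have v: "v = s *\<^sub>R rot (n a)" using orth_n[OF assms(1,3)] by (simp add: s_def)
  have "\<bar>s\<bar> = 1" using assms(2) norm_n[OF assms(1)] by (simp add: v norm_rot)
  then have "s * s = 1" by (metis abs_mult_self_eq mult_1)
  then have "(w \<bullet> v) *\<^sub>R v = (w \<bullet> rot (n a)) *\<^sub>R rot (n a)" by (simp add: v mult.assoc mult.left_commute)
  then show ?thesis using rot_decomposition[OF norm_n[OF assms(1)], of w] by (simp add: add.commute)
qed

end

theorem lemma6p4:
  fixes \<Omega> D M :: "(real^2) set" and A B :: "real^2"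
    and \<nu> n :: "real^2 \<Rightarrow> real^2"
    and \<Xi> :: "(real^2) set set" and J :: "(real^2) set \<Rightarrow> real"
  assumes "smoothly_1_cracked \<Omega> D M"
    and "mfd_boundary M = {A, B}"
    and "\<forall>p\<in>mfd_boundary M. outward_unit M p (\<nu> p)"
    and "unit_normal_field M n"
    and "\<forall>X\<in>C1c D. \<exists>l. has_eulerian_semiderivative \<Xi> J \<Omega> X l"
    and "linear_functional_on (C1c D) (eulerian_semiderivative \<Xi> J \<Omega>)"
    and "continuous_map (C1c_topology D) euclideanreal (eulerian_semiderivative \<Xi> J \<Omega>)"
  shows "\<exists>(\<alpha>\<^sub>1::real) (\<alpha>\<^sub>2::real) (h :: (real^2 \<Rightarrow> real) \<Rightarrow> real).
    linear_functional_on (C1_mfd M) h \<and>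
    continuous_map (C1_mfd_topology M) euclideanreal h \<and>
    (\<forall>X\<in>C1c D.
      (\<lambda>x. if x \<in> M then X x \<bullet> n x else 0) \<in> C1_mfd M \<and>
      eulerian_semiderivative \<Xi> J \<Omega> X =
        \<alpha>\<^sub>1 * (X A \<bullet> \<nu> A) + \<alpha>\<^sub>2 * (X B \<bullet> \<nu> B)
        + h (\<lambda>x. if x \<in> M then X x \<bullet> n x else 0))"
proof -
  have D: "open D" "M \<subseteq> D" "\<Omega> = D - M" and M: "compact M" "closed M" "C2_submanifold M"
    using assms(1) by (auto simp: smoothly_1_cracked_def compact_eq_bounded_closed)
  interpret normal_curve M n by unfold_locales (rule M(3), rule assms(4))
  have AB: "A \<in> M" "B \<in> M" using assms(2) by (auto simp: mfd_boundary_def)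
  have \<nu>: "norm (\<nu> p) = 1" "\<nu> p \<bullet> n p = 0" if "p \<in> {A, B}" for p
    using assms(2,3) that tangent_space_iff AB unfolding outward_unit_def by blast+
  define L where "L = eulerian_semiderivative \<Xi> J \<Omega>"
  have lin: "linear_functional_on (C1c D) L" using assms(6) by (simp add: L_def)
  have L_add: "L (\<lambda>x. X x + Y x) = L X + L Y" if "X \<in> C1c D" "Y \<in> C1c D" for X Y
    using lin that unfolding linear_functional_on_def by blast
  have L_scale: "L (\<lambda>x. c *\<^sub>R X x) = c * L X" if "X \<in> C1c D" for X c
    using lin that unfolding linear_functional_on_def by blast
  \<comment> \<open>Comparing two fields is the form used below for both the linearity of
    \<open>h\<close> and the formula itself; it reduces to their difference, whose flow maps
    \<open>\<Omega>\<close> onto itself.\<close>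
  have L_eq: "L X = L Y" if X: "X \<in> C1c D" and Y: "Y \<in> C1c D"
    and n: "\<And>x. x \<in> M \<Longrightarrow> X x \<bullet> n x = Y x \<bullet> n x" and "X A = Y A" "X B = Y B" for X Y
  proof -
    let ?Z = "\<lambda>x. X x - Y x"
    have Z: "?Z \<in> C1c D" using C1c_diff[OF X Y] .
    have "flow ?Z t ` (D - M) = D - M" for t
      by (rule flow_preserves_cracked_set[OF M(2) Z]) (use n that assms(2) in \<open>auto simp: inner_diff_left\<close>)
    then have "L ?Z = 0"
      unfolding L_def using eulerian_semiderivative_eq_0 assms(5) Z D(3) by blast
    then show ?thesis using linear_functional_on_diff[OF lin X Y Z] by simp
  qed
  obtain CL where CL: "CL \<ge> 0" "\<And>X B. X \<in> C1c D \<Longrightarrow> C1_bounded_on UNIV X B \<Longrightarrow> \<bar>L X\<bar> \<le> CL * B"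
    using C1c_functional_bound[of D L] lin assms(7) AB D(2) unfolding L_def by blast
  obtain N BN where N: "C1_bounded_on UNIV N BN" "\<And>x. x \<in> M \<Longrightarrow> N x = n x"
    using normal_extension[OF M(1) D(1,2)] by blast
  have N_C1: "C1_on UNIV N" using N(1) by (simp add: C1_bounded_on_def)
  have BN: "BN \<ge> 0" using N(1) norm_ge_zero order_trans unfolding C1_bounded_on_def by blast
  have nn: "n x \<bullet> n x = 1" if "x \<in> M" for x using norm_n[OF that] by (simp add: norm_eq_1)
  obtain K C E where K: "compact K" "K \<subseteq> D" "C \<ge> 0" and
    E: "\<And>f. f \<in> C1_mfd M \<Longrightarrow> C1_bounded_on UNIV (E f) (C * C1_mfd_norm M f)"
      "\<And>f x. f \<in> C1_mfd M \<Longrightarrow> x \<in> M \<Longrightarrow> E f x = f x" "\<And>f x. f \<in> C1_mfd M \<Longrightarrow> x \<notin> K \<Longrightarrow> E f x = 0"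
    by (rule C1_mfd_extension[OF M(1) D(1,2)]) (rule that)
  define W where "W f = (\<lambda>x. E f x *\<^sub>R N x)" for f
  have W: "W f \<in> C1c D" "C1_bounded_on UNIV (W f) (2 * (C * C1_mfd_norm M f) * BN)"
    "\<And>x. x \<in> M \<Longrightarrow> W f x = f x *\<^sub>R n x" if f: "f \<in> C1_mfd M" for f
  proof -
    show b: "C1_bounded_on UNIV (W f) (2 * (C * C1_mfd_norm M f) * BN)"
      unfolding W_def by (intro C1_bounded_on_scaleR E f N)
    show "W f \<in> C1c D"
      by (rule C1cI[OF _ K(1,2)]) (use b E(3)[OF f] in \<open>auto simp: C1_bounded_on_def W_def\<close>)
    show "W f x = f x *\<^sub>R n x" if "x \<in> M" for x
      using E(2)[OF f that] N(2)[OF that] by (simp add: W_def)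
  qed
  define h where "h f = L (W f)" for f
  have h_lin: "linear_functional_on (C1_mfd M) h"
    unfolding linear_functional_on_def
  proof (intro conjI ballI allI)
    fix f g assume fg: "f \<in> C1_mfd M" "g \<in> C1_mfd M"
    have "L (W (\<lambda>x. f x + g x)) = L (\<lambda>x. W f x + W g x)"
      by (rule L_eq) (use fg C1_mfd_add[OF fg] AB in \<open>auto simp: W C1c_add scaleR_add_left inner_add_left\<close>)
    then show "h (\<lambda>x. f x + g x) = h f + h g" using L_add W(1) fg by (simp add: h_def)
  next
    fix f c assume f: "f \<in> C1_mfd M"
    have "L (W (\<lambda>x. c *\<^sub>R f x)) = L (\<lambda>x. c *\<^sub>R W f x)"
      by (rule L_eq) (use f C1_mfd_scaleR[OF f, of c] AB in \<open>auto simp: W C1c_scaleR\<close>)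
    then show "h (\<lambda>x. c *\<^sub>R f x) = c * h f" using L_scale W(1)[OF f] by (simp add: h_def)
  qed
  have "continuous_map (C1_mfd_topology M) euclideanreal h"
    unfolding C1_mfd_topology_def
  proof (rule continuous_map_seminorm_topology[OF h_lin])
    show "(\<lambda>x. f x - g x) \<in> C1_mfd M" if "f \<in> C1_mfd M" "g \<in> C1_mfd M" for f g
      using C1_mfd_add[OF that(1) C1_mfd_scaleR[OF that(2), of "- 1"]] by simp
    show "C1_mfd_norm M (\<lambda>_. 0) = 0" using C1_mfd_norm_zero AB by blast
    show "0 \<le> CL * (2 * C * BN)" using CL(1) K(3) BN by simp
    show "\<bar>h f\<bar> \<le> CL * (2 * C * BN) * C1_mfd_norm M f" if "f \<in> C1_mfd M" for f
      using CL(2)[OF W(1,2)[OF that]] by (simp add: h_def mult_ac)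
  qed
  moreover
  \<comment> \<open>The last two facts say that the combination of \<open>Y\<close> and
    \<open>Z\<close> has the right tangential value at each tip, in a form that includes
    \<open>A = B\<close>. In that case \<open>Z\<close> is 0, so the tip is counted once.\<close>
  obtain Y Z where YZ: "Y \<in> C1c D" "Z \<in> C1c D" "\<And>x. x \<in> M \<Longrightarrow> Y x \<bullet> n x = 0" "\<And>x. x \<in> M \<Longrightarrow> Z x \<bullet> n x = 0"
    and YZ_A: "\<And>X. (X A \<bullet> \<nu> A) *\<^sub>R Y A + (X B \<bullet> \<nu> B) *\<^sub>R Z A = (X A \<bullet> \<nu> A) *\<^sub>R \<nu> A"
    and YZ_B: "\<And>X. (X A \<bullet> \<nu> A) *\<^sub>R Y B + (X B \<bullet> \<nu> B) *\<^sub>R Z B = (X B \<bullet> \<nu> B) *\<^sub>R \<nu> B"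
  proof (cases "A = B")
    case True
    obtain b :: "real^2" where "b \<noteq> A" using vector_choose_dist[of 1 A] by (metis dist_self zero_le_one zero_neq_one)
    then obtain Y where "Y \<in> C1c D" "\<And>x. x \<in> M \<Longrightarrow> Y x \<bullet> n x = 0" "Y A = \<nu> A"
      using tangential_field[OF N_C1 N(2) D(1,2) AB(1) _ \<nu>(2), of b] by blast
    moreover have "(\<lambda>_. 0) \<in> C1c D" by (rule C1cI[OF C1_on_const, of "{}"]) auto
    ultimately show ?thesis using that[of Y "\<lambda>_. 0"] True by simp
  next
    case False
    obtain Y where "Y \<in> C1c D" "\<And>x. x \<in> M \<Longrightarrow> Y x \<bullet> n x = 0" "Y A = \<nu> A" "Y B = 0"
      using tangential_field[OF N_C1 N(2) D(1,2) AB(1) False \<nu>(2)] by blast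
    moreover obtain Z where "Z \<in> C1c D" "\<And>x. x \<in> M \<Longrightarrow> Z x \<bullet> n x = 0" "Z B = \<nu> B" "Z A = 0"
      using tangential_field[OF N_C1 N(2) D(1,2) AB(2) False[symmetric] \<nu>(2)] by blast
    ultimately show ?thesis using that[of Y Z] by simp
  qed
  have "(\<lambda>x. if x \<in> M then X x \<bullet> n x else 0) \<in> C1_mfd M \<and>
      L X = L Y * (X A \<bullet> \<nu> A) + L Z * (X B \<bullet> \<nu> B) + h (\<lambda>x. if x \<in> M then X x \<bullet> n x else 0)"
    if X: "X \<in> C1c D" for X
  proof
    let ?f = "\<lambda>x. if x \<in> M then X x \<bullet> n x else 0"
    have "C1_on UNIV (\<lambda>x. X x \<bullet> N x)"
      using X N_C1 by (intro C1_on_inner) (auto simp: C1c_def)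
    from C1_mfd_restrict[OF this] show f: "?f \<in> C1_mfd M"
      by (simp add: N(2) cong: if_cong)
    \<comment> \<open>\<open>Y\<close> and \<open>Z\<close> contribute only tangential parts on
      \<open>M\<close>, and \<open>W ?f\<close> only the normal part. So \<open>?R\<close> has the
      normal component of \<open>X\<close> along \<open>M\<close> and its full value at the tips,
      though it may differ from \<open>X\<close> elsewhere.\<close>
    let ?R = "\<lambda>x. ((X A \<bullet> \<nu> A) *\<^sub>R Y x + (X B \<bullet> \<nu> B) *\<^sub>R Z x) + W ?f x"
    have YZ': "(\<lambda>x. (X A \<bullet> \<nu> A) *\<^sub>R Y x + (X B \<bullet> \<nu> B) *\<^sub>R Z x) \<in> C1c D"
      by (intro C1c_add C1c_scaleR YZ)
    have "L X = L ?R"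
    proof (rule L_eq[OF X])
      show "?R \<in> C1c D" by (intro C1c_add[OF YZ'] W f)
      show "X x \<bullet> n x = ?R x \<bullet> n x" if "x \<in> M" for x
        using that by (simp add: inner_add_left YZ W(3)[OF f] nn)
      show "X A = ?R A"
        unfolding YZ_A using endpoint_decomposition[OF AB(1) \<nu>] AB by (simp add: W(3)[OF f])
      show "X B = ?R B"
        unfolding YZ_B using endpoint_decomposition[OF AB(2) \<nu>] AB by (simp add: W(3)[OF f])
    qed
    also have "\<dots> = L Y * (X A \<bullet> \<nu> A) + L Z * (X B \<bullet> \<nu> B) + h ?f"
      using L_add[OF YZ' W(1)[OF f]] L_add[OF C1c_scaleR[OF YZ(1)] C1c_scaleR[OF YZ(2)]]
      by (simp add: L_scale YZ h_def mult.commute)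
    finally show "L X = L Y * (X A \<bullet> \<nu> A) + L Z * (X B \<bullet> \<nu> B) + h ?f" .
  qed
  ultimately show ?thesis using h_lin unfolding L_def by blast
qed

end
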